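(* Let $(X,d,\mu)$ be a quasi-metric-measure space such that $\mu(X)<\infty$ and $\mu$ is locally lower $s$-Ahlfors-regular for some $s\in(0,\infty)$, i.e., there exists a constant $b\in(0,\infty)$ such that $\mu(B_d(x,r))\ge br^s$ for all $x\in X$ and $r\in(0,1]$. Then the following statements are valid for all $\alpha,p\in(0,\infty)$: (1) If $\alpha p<s$, then $M^{\alpha,p}(X,d,\mu)\hookrightarrow L^{sp/(s-\alpha p)}(X,\mu)$ continuously, and for each fixed $\tilde p\in(0,sp/(s-\alpha p))$ the embedding $M^{\alpha,p}(X,d,\mu)\hookrightarrow L^{\tilde p}(X,\mu)$ is compact. (2) If $\alpha p>s$, then $M^{\alpha,p}(X,d,\mu)\hookrightarrow\mathcal C^{\alpha-s/p}(X,d)$ continuously, and for each fixed $\gamma\in(0,\alpha-s/p)$ the embedding $M^{\alpha,p}(X,d,\mu)\hookrightarrow\mathcal C^{\gamma}(X,d)$ is compact. In particular, the embedding $M^{\alpha,p}(X,d,\mu)\hookrightarrow L^{\tilde p}(X,\mu)$ is compact for all $\tilde p\in(0,\infty)$.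
   Context: A quasi-metric space $(X,d)$ is a set $X$ with at least two elements and a function $d:X\times X\to[0,\infty)$ for which there are constants $C_0,C_1\in(0,\infty)$ such that for all $x,y,z\in X$: $d(x,y)=0$ iff $x=y$; $d(y,x)\le C_0 d(x,y)$; $d(x,y)\le C_1\max\{d(x,z),d(z,y)\}$ (symmetry is not required). Balls are $B_d(x,r):=\{y\in X:d(x,y)<r\}$. The topology $\tau_d$ consists of all $\mathcal O\subseteq X$ such that for each $x\in\mathcal O$ there is $r>0$ with $B_d(x,r)\subseteq\mathcal O$. A quasi-metric-measure space $(X,d,\mu)$ is a quasi-metric space with a nonnegative measure $\mu$ on a $\sigma$-algebra containing the Borel sets of $\tau_d$, such that all $d$-balls are measurable and $\mu(B_d(x,r))\in(0,\infty)$ for all $x\in X$, $r\in(0,\infty)$. Hajłasz–Sobolev space: for $\alpha,p\in(0,\infty)$ and measurable $u:X\to\mathbb R$, $\mathcal D_d^\alpha(u)$ is the set of nonnegative measurable functions $g$ on $X$ for which there is a measurable $E\subseteq X$ with $\mu(E)=0$ and $|u(x)-u(y)|\le[d(x,y)]^\alpha(g(x)+g(y))$ for all $x,y\in X\setminus E$. $M^{\alpha,p}(X,d,\mu)$ is the set of $u\in L^p(X,\mu)$ with finite (quasi-)norm $\|u\|_{L^p(X,\mu)}+\inf_{g\in\mathcal D_d^\alpha(u)}\|g\|_{L^p(X,\mu)}$. Hölder space: for $\beta\in(0,\infty)$, $\mathcal C^\beta(X,d)$ is the set of bounded $f:X\to\mathbb R$ with finite norm $\sup_{x\in X}|f(x)|+\sup_{x\ne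 y}\frac{|f(x)-f(y)|}{[d(x,y)]^\beta}$. Functions are identified when equal $\mu$-a.e.; an embedding into $\mathcal C^\beta(X,d)$ means that each $u$ agrees $\mu$-a.e. with a (necessarily unique) element of $\mathcal C^\beta(X,d)$. An embedding is continuous if this natural map is well defined and bounded for the (quasi-)norms; it is compact if it moreover maps bounded sets to totally bounded sets. *)

theory Defs
  imports "HOL-Analysis.Analysis"
begin

locale quasi_metric_space =
  fixes X :: "'a set" and d :: "'a \<Rightarrow> 'a \<Rightarrow> real"
  assumes two_points: "\<exists>x\<in>X. \<exists>y\<in>X. x \<noteq> y"
    and nonneg: "\<lbrakk>x \<in> X; y \<in> X\<rbrakk> \<Longrightarrow> 0 \<le> d x y"
    and zero_iff: "\<lbrakk>x \<in> X; y \<in> X\<rbrakk> \<Longrightarrow> d x y = 0 \<longleftrightarrow> x = y"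
    and quasi_symmetric: "\<exists>C\<^sub>0>0. \<forall>x\<in>X. \<forall>y\<in>X. d y x \<le> C\<^sub>0 * d x y"
    and quasi_ultrametric:
      "\<exists>C\<^sub>1>0. \<forall>x\<in>X. \<forall>y\<in>X. \<forall>z\<in>X. d x y \<le> C\<^sub>1 * max (d x z) (d z y)"

definition qball :: "'a set \<Rightarrow> ('a \<Rightarrow> 'a \<Rightarrow> real) \<Rightarrow> 'a \<Rightarrow> real \<Rightarrow> 'a set" where
  "qball X d x r = {y \<in> X. d x y < r}"

definition qtopology :: "'a set \<Rightarrow> ('a \<Rightarrow> 'a \<Rightarrow> real) \<Rightarrow> 'a topology" where
  "qtopology X d = topology (\<lambda>U. U \<subseteq> X \<and> (\<forall>x\<in>U. \<exists>r>0. qball X d x r \<subseteq> U))"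

lemma openin_qtopology:
  "openin (qtopology X d) U \<longleftrightarrow> U \<subseteq> X \<and> (\<forall>x\<in>U. \<exists>r>0. qball X d x r \<subseteq> U)"
proof -
  have "istopology (\<lambda>U. U \<subseteq> X \<and> (\<forall>x\<in>U. \<exists>r>0. qball X d x r \<subseteq> U))"
    unfolding istopology_def
  proof (intro conjI allI impI ballI)
    fix S T x
    assume S: "S \<subseteq> X \<and> (\<forall>x\<in>S. \<exists>r>0. qball X d x r \<subseteq> S)"
      and T: "T \<subseteq> X \<and> (\<forall>x\<in>T. \<exists>r>0. qball X d x r \<subseteq> T)"
    show "S \<inter> T \<subseteq> X" using S by blast
    assume "x \<in> S \<inter> T"
    then obtain r r' where "0 < r" "qball X d x r \<subseteq> S" "0 < r'" "qball X d x r' \<subseteq> T"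
      using S T by blast
    then show "\<exists>r>0. qball X d x r \<subseteq> S \<inter> T"
      by (intro exI[of _ "min r r'"]) (auto simp: qball_def)
  next
    fix K x
    assume K: "\<forall>U\<in>K. U \<subseteq> X \<and> (\<forall>x\<in>U. \<exists>r>0. qball X d x r \<subseteq> U)"
    show "\<Union>K \<subseteq> X" using K by blast
    assume "x \<in> \<Union>K"
    then show "\<exists>r>0. qball X d x r \<subseteq> \<Union>K" using K by (meson Sup_upper UnionE subset_trans)
  qed
  then show ?thesis by (simp add: qtopology_def topology_inverse')
qed

text \<open>The underlying set \<open>X\<close> is \<open>space M\<close>; functions on \<open>X\<close> are represented by total
  functions whose values outside \<open>space M\<close> are never inspected.\<close>

locale quasi_metric_measure_space = quasi_metric_space "space M" d
  for M :: "'a measure" and d :: "'a \<Rightarrow> 'a \<Rightarrow> real" +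
  assumes borel_sets: "sigma_sets (space M) {U. openin (qtopology (space M) d) U} \<subseteq> sets M"
    and ball_sets: "\<lbrakk>x \<in> space M; 0 < r\<rbrakk> \<Longrightarrow> qball (space M) d x r \<in> sets M"
    and ball_pos: "\<lbrakk>x \<in> space M; 0 < r\<rbrakk> \<Longrightarrow> 0 < emeasure M (qball (space M) d x r)"
    and ball_finite: "\<lbrakk>x \<in> space M; 0 < r\<rbrakk> \<Longrightarrow> emeasure M (qball (space M) d x r) < \<infinity>"

definition locally_lower_ahlfors_regular ::
    "'a measure \<Rightarrow> ('a \<Rightarrow> 'a \<Rightarrow> real) \<Rightarrow> real \<Rightarrow> bool" where
  "locally_lower_ahlfors_regular M d s \<longleftrightarrow>
     (\<exists>b>0. \<forall>x\<in>space M. \<forall>r\<in>{0<..1}.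
        ennreal (b * r powr s) \<le> emeasure M (qball (space M) d x r))"

text \<open>All (quasi-)norms are \<open>ennreal\<close>-valued, so that the spaces are the sets of functions of
  finite norm. The case distinction is needed because \<open>powr\<close> is not available on \<open>ennreal\<close>.\<close>

definition Lp_norm :: "'a measure \<Rightarrow> real \<Rightarrow> ('a \<Rightarrow> real) \<Rightarrow> ennreal" where
  "Lp_norm M p u =
     (let I = (\<integral>\<^sup>+x. ennreal (\<bar>u x\<bar> powr p) \<partial>M)
      in if I = \<infinity> then \<infinity> else ennreal (enn2real I powr (1 / p)))"

definition Lp_space :: "'a measure \<Rightarrow> real \<Rightarrow> ('a \<Rightarrow> real) set" where
  "Lp_space M p = {u \<in> borel_measurable M. Lp_norm M p u < \<infinity>}"

definition hajlasz_gradients ::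
    "'a measure \<Rightarrow> ('a \<Rightarrow> 'a \<Rightarrow> real) \<Rightarrow> real \<Rightarrow> ('a \<Rightarrow> real) \<Rightarrow> ('a \<Rightarrow> real) set" where
  "hajlasz_gradients M d \<alpha> u =
     {g \<in> borel_measurable M. (\<forall>x\<in>space M. 0 \<le> g x) \<and>
        (\<exists>E\<in>sets M. emeasure M E = 0 \<and>
           (\<forall>x\<in>space M - E. \<forall>y\<in>space M - E.
              \<bar>u x - u y\<bar> \<le> d x y powr \<alpha> * (g x + g y)))}"

text \<open>The infimum over an empty set of gradients is \<open>\<infinity>\<close>.\<close>

definition hajlasz_norm ::
    "'a measure \<Rightarrow> ('a \<Rightarrow> 'a \<Rightarrow> real) \<Rightarrow> real \<Rightarrow> real \<Rightarrow> ('a \<Rightarrow> real) \<Rightarrow> ennreal" where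
  "hajlasz_norm M d \<alpha> p u = Lp_norm M p u + (INF g\<in>hajlasz_gradients M d \<alpha> u. Lp_norm M p g)"

definition hajlasz_space ::
    "'a measure \<Rightarrow> ('a \<Rightarrow> 'a \<Rightarrow> real) \<Rightarrow> real \<Rightarrow> real \<Rightarrow> ('a \<Rightarrow> real) set" where
  "hajlasz_space M d \<alpha> p = {u \<in> Lp_space M p. hajlasz_norm M d \<alpha> p u < \<infinity>}"

definition holder_norm ::
    "'a set \<Rightarrow> ('a \<Rightarrow> 'a \<Rightarrow> real) \<Rightarrow> real \<Rightarrow> ('a \<Rightarrow> real) \<Rightarrow> ennreal" where
  "holder_norm X d \<beta> f =
     (SUP x\<in>X. ennreal \<bar>f x\<bar>) +
     (SUP (x, y)\<in>{(x, y). x \<in> X \<and> y \<in> X \<and> x \<noteq> y}. ennreal (\<bar>f x - f y\<bar> / d x y powr \<beta>))"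

definition holder_space ::
    "'a set \<Rightarrow> ('a \<Rightarrow> 'a \<Rightarrow> real) \<Rightarrow> real \<Rightarrow> ('a \<Rightarrow> real) set" where
  "holder_space X d \<beta> = {f. bounded (f ` X) \<and> holder_norm X d \<beta> f < \<infinity>}"

text \<open>A function space is given by its set of representatives \<open>A\<close> and its (quasi-)norm \<open>N\<close>.
  The natural map sends the class of \<open>u \<in> A\<close> to the class of any \<open>v \<in> B\<close> with \<open>u = v\<close> almost
  everywhere. The second conjunct says that the image is unique as an element of the target: norm
  zero of a difference means equality almost everywhere in \<open>Lp_space\<close>, and equality at every
  point of \<open>X\<close> in \<open>holder_space\<close>.\<close>

definition continuous_embedding ::
    "'a measure \<Rightarrow> ('a \<Rightarrow> real) set \<Rightarrow> (('a \<Rightarrow> real) \<Rightarrow> ennreal) \<Rightarrow>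
     ('a \<Rightarrow> real) set \<Rightarrow> (('a \<Rightarrow> real) \<Rightarrow> ennreal) \<Rightarrow> bool" where
  "continuous_embedding M A N\<^sub>A B N\<^sub>B \<longleftrightarrow>
     (\<forall>u\<in>A. \<exists>v\<in>B. AE x in M. u x = v x) \<and>
     (\<forall>u\<in>A. \<forall>v\<in>B. \<forall>w\<in>B. (AE x in M. u x = v x) \<longrightarrow> (AE x in M. u x = w x) \<longrightarrow>
        N\<^sub>B (\<lambda>x. v x - w x) = 0) \<and>
     (\<exists>C::real. \<forall>u\<in>A. \<forall>v\<in>B. (AE x in M. u x = v x) \<longrightarrow> N\<^sub>B v \<le> ennreal C * N\<^sub>A u)"

definition totally_bounded_norm ::
    "(('a \<Rightarrow> real) \<Rightarrow> ennreal) \<Rightarrow> ('a \<Rightarrow> real) set \<Rightarrow> bool" where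
  "totally_bounded_norm N S \<longleftrightarrow>
     (\<forall>\<epsilon>::real. \<epsilon> > 0 \<longrightarrow>
        (\<exists>F. finite F \<and> F \<subseteq> S \<and> (\<forall>v\<in>S. \<exists>w\<in>F. N (\<lambda>x. v x - w x) < ennreal \<epsilon>)))"

definition compact_embedding ::
    "'a measure \<Rightarrow> ('a \<Rightarrow> real) set \<Rightarrow> (('a \<Rightarrow> real) \<Rightarrow> ennreal) \<Rightarrow>
     ('a \<Rightarrow> real) set \<Rightarrow> (('a \<Rightarrow> real) \<Rightarrow> ennreal) \<Rightarrow> bool" where
  "compact_embedding M A N\<^sub>A B N\<^sub>B \<longleftrightarrow>
     continuous_embedding M A N\<^sub>A B N\<^sub>B \<and>
     (\<forall>S\<subseteq>A. (\<exists>K::real. \<forall>u\<in>S. N\<^sub>A u \<le> ennreal K) \<longrightarrow>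
        totally_bounded_norm N\<^sub>B {v \<in> B. \<exists>u\<in>S. AE x in M. u x = v x})"

end

theory Submission
  imports Defs
begin

text \<open>
  Everything rests on one observation. Let \<open>g\<close> be a gradient of \<open>u\<close>, let \<open>K\<close> bound the \<open>L\<^sup>p\<close> norms
  of both functions, and consider a ball of radius \<open>r \<le> 1\<close>. It has measure at least \<open>b * r powr s\<close>,
  whereas by Chebyshev's inequality the set where \<open>g\<close> or \<open>\<bar>u\<bar>\<close> exceeds a suitable
  multiple of \<open>K * r powr (- s / p)\<close> has smaller measure. So every ball contains a point at which both functions
  are of size at most \<open>K * r powr (- s / p)\<close> up to a constant (\<open>good_point\<close>).

  Fix a center \<open>x\<close> and choose such a point \<open>pt x j\<close> in the ball of radius \<open>(1 / 2) ^ j\<close> for each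
  \<open>j\<close>. By the gradient inequality \<open>u\<close> changes between consecutive points by at most a multiple of
  \<open>K * \<theta> ^ j\<close> with \<open>\<theta> = 2 powr (s / p - \<alpha>)\<close>; since all points are compared through the center,
  the quasi-metric constants enter only a bounded number of times. Two regimes arise.

  If \<open>s < \<alpha> * p\<close>, then \<open>\<theta> < 1\<close>, the values along the sequence converge geometrically, and the limit
  is a representative of \<open>u\<close> at every point. Comparing the sequences of two points at the scale of
  their distance gives Hoelder continuity with exponent \<open>\<alpha> - s / p\<close> (\<open>rep_holder\<close>).

  If \<open>\<alpha> * p < s\<close>, then \<open>\<theta> > 1\<close> and the sum of the changes is dominated by its last term. Stopping
  at the scale where the admissible size of the gradient reaches \<open>g x\<close> bounds \<open>\<bar>u x\<bar>\<close> by a multiple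
  of \<open>K * (max (g x / K) 1) powr (1 - \<alpha> * p / s)\<close> (\<open>pointwise_bound\<close>); since
  \<open>(1 - \<alpha> * p / s) * (s * p / (s - \<alpha> * p)) = p\<close>, integrating this bound proves the Sobolev
  embedding.

  For compactness, the finite total measure and the lower volume bound make the space totally
  bounded (\<open>finite_net\<close>). Each function of a bounded family is given a label from a finite set,
  consisting of its values at one point near each node of a net, rounded to a grid. Functions with
  equal labels are close: uniformly for Hoelder functions (\<open>totally_bounded_holder\<close>), and in measure
  for Hajlasz functions, where the values are read off at points at which function and gradient are
  below a threshold and where the rest of the space has small measure (\<open>totally_bounded_Lp\<close>).
  Interpolation with the stronger norm, which is bounded on the family, turns this into closeness
  in the target norm.
\<close>

section \<open>Integral estimates and a criterion for total boundedness\<close>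

lemma Lp_norm_le_iff:
  assumes "0 < p" "0 \<le> K"
  shows "Lp_norm M p u \<le> ennreal K \<longleftrightarrow> (\<integral>\<^sup>+x. ennreal (\<bar>u x\<bar> powr p) \<partial>M) \<le> ennreal (K powr p)"
proof (cases "(\<integral>\<^sup>+x. ennreal (\<bar>u x\<bar> powr p) \<partial>M)")
  case (real a)
  have "a powr (1 / p) \<le> K \<longleftrightarrow> a \<le> K powr p"
  proof
    assume "a powr (1 / p) \<le> K"
    then have "(a powr (1 / p)) powr p \<le> K powr p"
      using assms by (intro powr_mono2) auto
    then show "a \<le> K powr p"
      using real assms by (simp add: powr_powr)
  next
    assume "a \<le> K powr p"
    then have "a powr (1 / p) \<le> (K powr p) powr (1 / p)"
      using real assms by (intro powr_mono2) auto
    then show "a powr (1 / p) \<le> K"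
      using assms by (simp add: powr_powr)
  qed
  then show ?thesis
    using real assms by (simp add: Lp_norm_def Let_def)
next
  case top
  then show ?thesis
    by (simp add: Lp_norm_def Let_def top_unique)
qed

lemma Lp_norm_cong_AE:
  assumes "AE x in M. u x = v x"
  shows "Lp_norm M p u = Lp_norm M p v"
proof -
  have "(\<integral>\<^sup>+x. ennreal (\<bar>u x\<bar> powr p) \<partial>M) = (\<integral>\<^sup>+x. ennreal (\<bar>v x\<bar> powr p) \<partial>M)"
    using assms by (intro nn_integral_cong_AE) auto
  then show ?thesis by (simp add: Lp_norm_def)
qed

text \<open>This is Chebyshev's inequality in the normalization used below, where \<open>K\<close> plays the part of
  the \<open>L\<^sup>p\<close> norm.\<close>
lemma emeasure_superlevel_le:
  assumes u: "u \<in> borel_measurable M" and "0 < p" "0 < t" "0 \<le> K"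
    and int: "(\<integral>\<^sup>+x. ennreal (\<bar>u x\<bar> powr p) \<partial>M) \<le> ennreal (K powr p)"
  shows "emeasure M {x \<in> space M. t < \<bar>u x\<bar>} \<le> ennreal ((K / t) powr p)"
proof -
  let ?f = "\<lambda>x. ennreal (\<bar>u x\<bar> powr p)"
  have sub: "{x \<in> space M. t < \<bar>u x\<bar>} \<subseteq> {x \<in> space M. 1 \<le> ennreal (t powr (- p)) * ?f x}"
  proof clarify
    fix x assume "t < \<bar>u x\<bar>"
    then have "t powr p \<le> \<bar>u x\<bar> powr p" using assms by (intro powr_mono2) auto
    then have "1 \<le> t powr (- p) * \<bar>u x\<bar> powr p"
      using assms by (simp add: powr_minus field_simps)
    then show "1 \<le> ennreal (t powr (- p)) * ?f x"
      by (simp add: ennreal_mult[symmetric] ennreal_1[symmetric] del: ennreal_1)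
  qed
  have "emeasure M {x \<in> space M. t < \<bar>u x\<bar>} \<le>
      emeasure M {x \<in> space M. 1 \<le> ennreal (t powr (- p)) * ?f x}"
    using u by (intro emeasure_mono[OF sub]) measurable
  also have "\<dots> \<le> ennreal (t powr (- p)) * (\<integral>\<^sup>+x. ?f x * indicator (space M) x \<partial>M)"
    using nn_integral_Markov_inequality[of ?f "space M" M "ennreal (t powr (- p))"] u by simp
  also have "(\<integral>\<^sup>+x. ?f x * indicator (space M) x \<partial>M) = (\<integral>\<^sup>+x. ?f x \<partial>M)"
    by (intro nn_integral_cong) simp
  also have "ennreal (t powr (- p)) * \<dots> \<le> ennreal (t powr (- p)) * ennreal (K powr p)"
    by (intro mult_left_mono int) auto
  also have "\<dots> = ennreal ((K / t) powr p)"
    using assms by (simp add: ennreal_mult[symmetric] powr_minus powr_divide field_simps)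
  finally show ?thesis .
qed

text \<open>A finite set of representatives must be taken from \<open>S\<close> itself. Choosing one function for each
  label achieves this without a triangle inequality, which a quasi-norm has only up to a constant.\<close>
lemma totally_bounded_normI:
  assumes "\<And>\<epsilon>::real. 0 < \<epsilon> \<Longrightarrow> \<exists>label :: ('a \<Rightarrow> real) \<Rightarrow> 'b.
    finite (label ` S) \<and> (\<forall>v\<in>S. \<forall>w\<in>S. label v = label w \<longrightarrow> N (\<lambda>x. v x - w x) < ennreal \<epsilon>)"
  shows "totally_bounded_norm N S"
  unfolding totally_bounded_norm_def
proof (intro allI impI)
  fix \<epsilon> :: real assume "0 < \<epsilon>"
  then obtain label :: "('a \<Rightarrow> real) \<Rightarrow> 'b" where fin: "finite (label ` S)"
    and close: "\<forall>v\<in>S. \<forall>w\<in>S. label v = label w \<longrightarrow> N (\<lambda>x. v x - w x) < ennreal \<epsilon>"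
    using assms by blast
  let ?r = "inv_into S label"
  show "\<exists>F. finite F \<and> F \<subseteq> S \<and> (\<forall>v\<in>S. \<exists>w\<in>F. N (\<lambda>x. v x - w x) < ennreal \<epsilon>)"
  proof (intro exI conjI ballI)
    show "finite (?r ` label ` S)" using fin by blast
    show "?r ` label ` S \<subseteq> S" by (auto intro: inv_into_into)
    fix v assume v: "v \<in> S"
    then have "?r (label v) \<in> S" "label (?r (label v)) = label v"
      by (simp_all add: inv_into_into f_inv_into_f)
    then show "\<exists>w\<in>?r ` label ` S. N (\<lambda>x. v x - w x) < ennreal \<epsilon>"
      using v close by (intro bexI[of _ "?r (label v)"]) auto
  qed
qed

text \<open>Splitting at the height \<open>R\<close>, this replaces Hoelder's inequality in all comparisons between
  Lebesgue norms on sets of finite measure. A large \<open>R\<close> makes the coefficient of the higher power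
  small.\<close>
lemma powr_le_interpolate:
  fixes t R :: real
  assumes "0 < q" "q \<le> Q" "0 < R" "0 \<le> t"
  shows "t powr q \<le> R powr (q - Q) * t powr Q + R powr q"
proof (cases "t \<le> R")
  case True
  then have "t powr q \<le> R powr q" using assms by (intro powr_mono2) auto
  then show ?thesis by (simp add: add_increasing)
next
  case False
  have "t powr q = t powr (q - Q) * t powr Q" using False assms by (simp add: powr_add[symmetric])
  also have "\<dots> \<le> R powr (q - Q) * t powr Q"
    using False assms by (intro mult_right_mono powr_mono2') auto
  finally show ?thesis using add_increasing2[OF powr_ge_zero] by blast
qed

lemma exists_small_powr:
  fixes W e a :: real
  assumes "0 \<le> W" "0 < e" "0 < a"
  obtains t where "0 < t" "W * t powr a \<le> e"
proof
  show "0 < (e / (W + 1)) powr (1 / a)" using assms by simp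
  show "W * ((e / (W + 1)) powr (1 / a)) powr a \<le> e"
    using assms by (simp add: powr_powr field_simps)
qed

lemma ennreal_less_imp_pos:
  assumes "N < ennreal K"
  shows "0 < K"
proof (rule ccontr)
  assume "\<not> 0 < K"
  then have "ennreal K = 0" by (simp add: ennreal_neg)
  then show False using assms by simp
qed

lemma bounded_set_uniform_bound:
  assumes "\<exists>K::real. \<forall>u\<in>S. N u \<le> ennreal K"
  obtains K where "0 < K" "\<And>u. u \<in> S \<Longrightarrow> N u < ennreal K"
proof -
  obtain K\<^sub>0 where K0: "\<forall>u\<in>S. N u \<le> ennreal K\<^sub>0" using assms by blast
  have "ennreal K\<^sub>0 < ennreal (max K\<^sub>0 0 + 1)" by (intro ennreal_lessI) auto
  then have "N u < ennreal (max K\<^sub>0 0 + 1)" if "u \<in> S" for u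
    using K0 that by (auto intro: le_less_trans)
  then show ?thesis by (intro that[of "max K\<^sub>0 0 + 1"]) auto
qed

lemma finite_labels:
  assumes "finite F" "finite B" "\<And>v i. \<lbrakk>v \<in> T; i \<in> F\<rbrakk> \<Longrightarrow> label v i \<in> B"
    "\<And>v i. i \<notin> F \<Longrightarrow> label v i = z"
  shows "finite (label ` T)"
proof (rule finite_subset)
  show "label ` T \<subseteq> {f. \<forall>i. (i \<in> F \<longrightarrow> f i \<in> B) \<and> (i \<notin> F \<longrightarrow> f i = z)}"
    using assms by auto
  show "finite \<dots>" by (rule finite_set_of_finite_funs[OF assms(1,2)])
qed

lemma floor_label_close:
  fixes a b \<delta> :: real
  assumes "\<lfloor>a / \<delta>\<rfloor> = \<lfloor>b / \<delta>\<rfloor>" "0 < \<delta>"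
  shows "\<bar>a - b\<bar> \<le> \<delta>"
proof -
  have "\<bar>a / \<delta> - b / \<delta>\<bar> \<le> 1" using assms(1) by linarith
  then have "\<bar>(a - b) / \<delta>\<bar> \<le> 1" by (simp add: diff_divide_distrib)
  then show ?thesis using assms(2) by (simp add: abs_divide)
qed

lemma floor_label_range:
  fixes a \<delta> R :: real
  assumes "\<bar>a\<bar> \<le> R" "0 < \<delta>"
  shows "\<lfloor>a / \<delta>\<rfloor> \<in> {\<lfloor>- R / \<delta>\<rfloor>..\<lfloor>R / \<delta>\<rfloor>}"
proof -
  have "- R / \<delta> \<le> a / \<delta>" "a / \<delta> \<le> R / \<delta>" using assms by (intro divide_right_mono; linarith)+
  then show ?thesis by (simp add: floor_mono)
qed

section \<open>Witnesses for a bound on the Hajlasz norm\<close>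

text \<open>All quantitative estimates are proved for a single gradient with a bound \<open>K\<close> on both norms.
  This avoids working with the infimum in the norm, which need not be attained.\<close>
definition hajlasz_witness where
  "hajlasz_witness M d \<alpha> p K u g E \<longleftrightarrow>
     u \<in> borel_measurable M \<and> g \<in> borel_measurable M \<and> E \<in> null_sets M \<and>
     (\<forall>x\<in>space M. 0 \<le> g x) \<and>
     (\<forall>x\<in>space M - E. \<forall>y\<in>space M - E. \<bar>u x - u y\<bar> \<le> d x y powr \<alpha> * (g x + g y)) \<and>
     (\<integral>\<^sup>+x. ennreal (\<bar>u x\<bar> powr p) \<partial>M) \<le> ennreal (K powr p) \<and>
     (\<integral>\<^sup>+x. ennreal (\<bar>g x\<bar> powr p) \<partial>M) \<le> ennreal (K powr p)"

lemma hajlasz_witness_exists: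
  assumes "u \<in> hajlasz_space M d \<alpha> p" "hajlasz_norm M d \<alpha> p u < ennreal K" "0 < p"
  obtains g E where "hajlasz_witness M d \<alpha> p K u g E"
proof -
  have u: "u \<in> borel_measurable M"
    using assms by (auto simp: hajlasz_space_def Lp_space_def)
  have K: "0 \<le> K" using assms(2) by (rule contrapos_pp) (simp add: ennreal_neg)
  have "(INF g\<in>hajlasz_gradients M d \<alpha> u. Lp_norm M p g) \<le> hajlasz_norm M d \<alpha> p u"
    by (simp add: hajlasz_norm_def add_increasing)
  then have "(INF g\<in>hajlasz_gradients M d \<alpha> u. Lp_norm M p g) < ennreal K"
    using assms(2) by (rule le_less_trans)
  then obtain g where g: "g \<in> hajlasz_gradients M d \<alpha> u" "Lp_norm M p g \<le> ennreal K"
    by (auto simp: INF_less_iff)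
  obtain E where E: "E \<in> null_sets M"
      "\<forall>x\<in>space M - E. \<forall>y\<in>space M - E. \<bar>u x - u y\<bar> \<le> d x y powr \<alpha> * (g x + g y)"
    using g(1) unfolding hajlasz_gradients_def null_sets_def by blast
  have "Lp_norm M p u \<le> hajlasz_norm M d \<alpha> p u"
    by (simp add: hajlasz_norm_def)
  then have "Lp_norm M p u \<le> ennreal K" using assms(2) by (rule order.trans[OF _ less_imp_le])
  then have "hajlasz_witness M d \<alpha> p K u g E"
    using g u E unfolding hajlasz_witness_def hajlasz_gradients_def Lp_norm_le_iff[OF assms(3) K]
    by blast
  then show ?thesis using that by blast
qed

lemma hajlasz_witness_cong_AE:
  assumes wit: "hajlasz_witness M d \<alpha> p K u g E" and v: "v \<in> borel_measurable M"
    and ae: "AE x in M. u x = v x"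
  obtains E' where "hajlasz_witness M d \<alpha> p K v g E'"
proof -
  obtain N where N: "N \<in> null_sets M" "{x \<in> space M. u x \<noteq> v x} \<subseteq> N"
    using ae by (auto elim!: AE_E)
  have "(\<integral>\<^sup>+x. ennreal (\<bar>u x\<bar> powr p) \<partial>M) = (\<integral>\<^sup>+x. ennreal (\<bar>v x\<bar> powr p) \<partial>M)"
    using ae by (intro nn_integral_cong_AE) auto
  moreover have eq: "u x = v x" if "x \<in> space M - (E \<union> N)" for x using that N by blast
  have "\<forall>x\<in>space M - (E \<union> N). \<forall>y\<in>space M - (E \<union> N).
      \<bar>v x - v y\<bar> \<le> d x y powr \<alpha> * (g x + g y)"
    using wit unfolding hajlasz_witness_def by (simp add: eq[symmetric])
  ultimately have "hajlasz_witness M d \<alpha> p K v g (E \<union> N)"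
    using wit v N(1) unfolding hajlasz_witness_def by (simp add: null_sets.Un)
  then show ?thesis using that by blast
qed

text \<open>Estimates obtained from a witness hold for each \<open>K\<close> strictly above the norm; letting \<open>K\<close>
  decrease to the norm makes them linear in it.\<close>
lemma norm_bound_from_strict:
  fixes N :: ennreal and NB :: ennreal
  assumes "N < \<infinity>" "0 \<le> C" and "\<And>K. N < ennreal K \<Longrightarrow> NB \<le> ennreal (C * K)"
  shows "NB \<le> ennreal C * N"
proof (cases N)
  case (real n)
  show ?thesis
  proof (rule ennreal_le_epsilon)
    fix e :: real assume e: "0 < e"
    define K where "K = n + e / (C + 1)"
    have "n < K" using e assms by (simp add: K_def)
    then have "NB \<le> ennreal (C * K)" using real by (intro assms) (simp add: ennreal_less_iff)
    also have "C * K \<le> C * n + e"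
    proof -
      have "C * (e / (C + 1)) \<le> e" using e assms by (simp add: field_simps)
      then show ?thesis by (simp add: K_def distrib_left)
    qed
    then have "ennreal (C * K) \<le> ennreal (C * n + e)" by (rule ennreal_leI)
    also have "\<dots> = ennreal C * N + ennreal e"
      using real e assms by (simp add: ennreal_mult)
    finally show "NB \<le> ennreal C * N + ennreal e" .
  qed
qed (use assms in simp)

section \<open>Finite nets in a space with a lower volume bound\<close>

text \<open>A single \<open>c \<ge> 1\<close> replaces both quasi-metric constants.\<close>
locale ahlfors_space = quasi_metric_measure_space M d
  for M :: "'a measure" and d :: "'a \<Rightarrow> 'a \<Rightarrow> real" +
  fixes s b c :: real
  assumes finite_total: "emeasure M (space M) < \<infinity>"
    and s_pos: "0 < s" and b_pos: "0 < b" and c_ge1: "1 \<le> c"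
    and lower: "\<lbrakk>x \<in> space M; 0 < r; r \<le> 1\<rbrakk> \<Longrightarrow>
      ennreal (b * r powr s) \<le> emeasure M (qball (space M) d x r)"
    and sym: "\<lbrakk>x \<in> space M; y \<in> space M\<rbrakk> \<Longrightarrow> d y x \<le> c * d x y"
    and tri: "\<lbrakk>x \<in> space M; y \<in> space M; z \<in> space M\<rbrakk> \<Longrightarrow> d x y \<le> c * max (d x z) (d z y)"
begin

sublocale finite_measure M
  using finite_total by (intro finite_measureI) (simp add: less_top)

lemma near_common_center:
  assumes "x \<in> space M" "y \<in> qball (space M) d x r" "z \<in> qball (space M) d x r"
  shows "d y z < c\<^sup>2 * r"
proof -
  have yz: "y \<in> space M" "z \<in> space M" "d x y < r" "d x z < r"
    using assms by (auto simp: qball_def)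
  have "0 \<le> d x y" using assms yz by (simp add: nonneg)
  have cr: "c * d v w < c * r" if "d v w < r" for v w
    using that c_ge1 by simp
  have "d y x < c * r"
    using sym[OF assms(1) yz(1)] cr[OF yz(3)] by linarith
  moreover have "r \<le> c * r"
    using c_ge1 yz(3) \<open>0 \<le> d x y\<close> mult_right_mono[of 1 c r] by simp
  then have "d x z < c * r" using yz by linarith
  ultimately have "max (d y x) (d x z) < c * r" by simp
  then have "c * max (d y x) (d x z) < c * (c * r)" using c_ge1 by simp
  then show ?thesis using tri[OF yz(1,2) assms(1)] by (simp add: power2_eq_square)
qed

text \<open>Balls of a radius smaller by the factor \<open>c\<^sup>2\<close> around the points of a separated set are disjoint,
  and each carries a fixed amount of the finite total mass. So the size of separated sets is bounded,
  and a separated set of maximal size is a net.\<close>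
lemma finite_net:
  assumes "0 < r"
  obtains F where "finite F" "F \<subseteq> space M" "space M \<subseteq> (\<Union>x\<in>F. qball (space M) d x r)"
proof -
  define \<rho> where "\<rho> = min r 1 / c\<^sup>2"
  have "min r 1 \<le> c\<^sup>2" using one_le_power[OF c_ge1, of 2] by linarith
  then have \<rho>: "0 < \<rho>" "\<rho> \<le> 1" "c\<^sup>2 * \<rho> \<le> r"
    using assms c_ge1 one_le_power[OF c_ge1, of 2] by (auto simp: \<rho>_def divide_le_eq)
  \<comment> \<open>Being far apart in one of the two directions is all that maximality yields and all that
    disjointness of the balls needs, as \<open>d\<close> is not symmetric.\<close>
  define sep where "sep F \<longleftrightarrow> finite F \<and> F \<subseteq> space M \<and>
      (\<forall>x\<in>F. \<forall>y\<in>F. x \<noteq> y \<longrightarrow> r \<le> d x y \<or> r \<le> d y x)" for F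
  define \<beta> where "\<beta> = b * \<rho> powr s"
  have \<beta>: "0 < \<beta>" unfolding \<beta>_def using b_pos \<rho>(1) by simp
  have card_le: "card F \<le> nat \<lfloor>measure M (space M) / \<beta>\<rfloor>" if "sep F" for F
  proof -
    let ?B = "\<lambda>x. qball (space M) d x \<rho>"
    have F: "finite F" "F \<subseteq> space M" using that by (auto simp: sep_def)
    have disj: "disjoint_family_on ?B F"
      unfolding disjoint_family_on_def
    proof (intro ballI impI)
      fix x y assume xy: "x \<in> F" "y \<in> F" "x \<noteq> y"
      show "?B x \<inter> ?B y = {}"
      proof (rule ccontr)
        assume "?B x \<inter> ?B y \<noteq> {}"
        then obtain z where z: "z \<in> space M" "d x z < \<rho>" "d y z < \<rho>" by (auto simp: qball_def)
        have sp: "x \<in> space M" "y \<in> space M" using xy F by auto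
        have small: "d v w < r" if "v \<in> space M" "w \<in> space M" "d v z < \<rho>" "d w z < \<rho>" for v w
        proof -
          have "c * d w z < c * \<rho>" using that c_ge1 by simp
          then have "d z w < c * \<rho>"
            using sym[OF that(2) z(1)] by linarith
          moreover have "\<rho> \<le> c * \<rho>"
            using c_ge1 \<rho> mult_right_mono[of 1 c \<rho>] by simp
          then have "d v z < c * \<rho>"
            using that(3) by linarith
          ultimately have "c * max (d v z) (d z w) < c * (c * \<rho>)" using c_ge1 by simp
          then show ?thesis using tri[OF that(1,2) z(1)] \<rho>(3) by (simp add: power2_eq_square)
        qed
        show False using xy that small[OF sp z(2,3)] small[OF sp(2,1) z(3,2)]
          by (force simp: sep_def)
      qed
    qed
    have meas: "?B x \<in> sets M" if "x \<in> F" for x using that F \<rho> by (auto intro: ball_sets)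
    have "real (card F) * \<beta> = (\<Sum>x\<in>F. \<beta>)" by simp
    also have "\<dots> \<le> (\<Sum>x\<in>F. measure M (?B x))"
    proof (intro sum_mono)
      fix x assume "x \<in> F"
      then have "ennreal \<beta> \<le> ennreal (measure M (?B x))"
        using lower[of x \<rho>] F \<rho> by (auto simp: \<beta>_def emeasure_eq_measure)
      then show "\<beta> \<le> measure M (?B x)" by simp
    qed
    also have "\<dots> = measure M (\<Union>x\<in>F. ?B x)"
      using F disj meas by (intro finite_measure_finite_Union[symmetric]) auto
    also have "\<dots> \<le> measure M (space M)" by (rule bounded_measure)
    finally have "real (card F) \<le> measure M (space M) / \<beta>" using \<beta> by (simp add: field_simps)
    then show ?thesis by linarith
  qed
  have "sep {}" by (simp add: sep_def)
  then obtain F where F: "sep F" "\<And>G. sep G \<Longrightarrow> card G \<le> card F"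
    using ex_has_greatest_nat[of sep "{}" card "Suc (nat \<lfloor>measure M (space M) / \<beta>\<rfloor>)"] card_le
    by (auto simp: less_Suc_eq_le)
  have "space M \<subseteq> (\<Union>x\<in>F. qball (space M) d x r)"
  proof (rule ccontr)
    assume "\<not> ?thesis"
    then obtain y where y: "y \<in> space M" "\<And>x. x \<in> F \<Longrightarrow> \<not> d x y < r"
      unfolding qball_def by blast
    have "d y y = 0" using zero_iff[OF y(1) y(1)] by blast
    then have "y \<notin> F" using y(2)[of y] assms by auto
    have "sep (insert y F)"
      using F(1) y unfolding sep_def by (auto simp: not_less)
    then have "card (insert y F) \<le> card F" by (rule F(2))
    then show False using F(1) \<open>y \<notin> F\<close> unfolding sep_def by simp
  qed
  then show ?thesis using that F(1) by (auto simp: sep_def)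
qed

end

section \<open>Pointwise estimates along points of controlled gradient\<close>

text \<open>The real constants defined here do not depend on \<open>u\<close>, \<open>g\<close>, \<open>E\<close> and \<open>K\<close>, so that every estimate is
  a multiple of \<open>K\<close> by a factor common to all functions.\<close>
locale hajlasz_function = ahlfors_space M d s b c
  for M :: "'a measure" and d :: "'a \<Rightarrow> 'a \<Rightarrow> real" and s b c :: real +
  fixes \<alpha> p K :: real and u g :: "'a \<Rightarrow> real" and E :: "'a set"
  assumes alpha_pos: "0 < \<alpha>" and p_pos: "0 < p" and K_pos: "0 < K"
    and witness: "hajlasz_witness M d \<alpha> p K u g E"
begin

text \<open>At the scale \<open>(1 / 2) ^ j\<close> the admissible size of gradient and function is \<open>K * A * L ^ j\<close>, where
  \<open>A\<close> comes from Chebyshev's inequality; the oscillation of \<open>u\<close> between points of that size is at most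
  \<open>K * D * \<theta> ^ j\<close>. The exponent \<open>2 * \<alpha>\<close> in \<open>D\<close> arises because two points of a ball of radius \<open>r\<close> have
  distance less than \<open>c\<^sup>2 * r\<close>.\<close>
definition L :: real where "L = 2 powr (s / p)"
definition \<theta> :: real where "\<theta> = 2 powr (s / p - \<alpha>)"
definition A :: real where "A = (4 / b) powr (1 / p)"
definition D :: real where "D = 2 * A * L * c powr (2 * \<alpha>)"

lemma u_meas: "u \<in> borel_measurable M" and g_meas: "g \<in> borel_measurable M"
  and E_null: "E \<in> null_sets M" and g_nonneg: "x \<in> space M \<Longrightarrow> 0 \<le> g x"
  and gradient: "\<lbrakk>x \<in> space M - E; y \<in> space M - E\<rbrakk> \<Longrightarrow>
      \<bar>u x - u y\<bar> \<le> d x y powr \<alpha> * (g x + g y)"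
  and u_int: "(\<integral>\<^sup>+x. ennreal (\<bar>u x\<bar> powr p) \<partial>M) \<le> ennreal (K powr p)"
  and g_int: "(\<integral>\<^sup>+x. ennreal (\<bar>g x\<bar> powr p) \<partial>M) \<le> ennreal (K powr p)"
  using witness unfolding hajlasz_witness_def by blast+

lemma A_pos: "0 < A" and D_pos: "0 < D" and L_gt1: "1 < L" and \<theta>_pos: "0 < \<theta>"
  using b_pos c_ge1 s_pos p_pos by (auto simp: A_def D_def L_def \<theta>_def)

lemma \<theta>_power: "(2 powr (- \<alpha>)) ^ j * L ^ j = \<theta> ^ j"
  by (simp add: L_def \<theta>_def power_mult_distrib[symmetric] powr_add[symmetric])

lemma half_powr: "((1 / 2) ^ j) powr \<alpha> = (2 powr (- \<alpha>)) ^ j"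
proof -
  have "((1 / 2 :: real) ^ j) powr \<alpha> = ((1 / 2) powr \<alpha>) ^ j"
    by (simp add: powr_power powr_realpow[symmetric] powr_powr mult.commute)
  then show ?thesis by (simp add: powr_divide powr_minus_divide)
qed

text \<open>With the factor \<open>4\<close> in \<open>A\<close>, each of the sets where \<open>u\<close> and \<open>g\<close> are too large has at most a
  quarter of the least possible measure of the ball, so that together they cannot cover it.\<close>
lemma good_point:
  assumes x: "x \<in> space M"
  obtains y where "y \<in> qball (space M) d x ((1 / 2) ^ j)" "y \<notin> E"
    "g y \<le> K * A * L ^ j" "\<bar>u y\<bar> \<le> K * A * L ^ j"
proof -
  define t where "t = K * A * L ^ j"
  define r :: real where "r = (1 / 2) ^ j"
  have r: "0 < r" "r \<le> 1" by (auto simp: r_def power_le_one)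
  have t: "0 < t" using K_pos A_pos L_gt1 by (simp add: t_def)
  have "(K / t) powr p = (b / 4) * r powr s"
  proof -
    have "(K / t) powr p = 1 / (A powr p * (L ^ j) powr p)"
      using K_pos A_pos L_gt1 by (simp add: t_def powr_divide powr_mult)
    also have "A powr p = 4 / b" using b_pos p_pos by (simp add: A_def powr_powr)
    also have "(L ^ j) powr p = 2 powr (j * s)"
      using p_pos by (simp add: L_def powr_power powr_powr)
    also have "2 powr (j * s) = 1 / r powr s"
      by (simp add: r_def powr_divide powr_powr powr_realpow[symmetric] power_one_over)
    finally show ?thesis by simp
  qed
  note level = this
  have u_bad: "emeasure M {x \<in> space M. t < \<bar>u x\<bar>} \<le> ennreal (b / 4 * r powr s)"
    and g_bad: "emeasure M {x \<in> space M. t < \<bar>g x\<bar>} \<le> ennreal (b / 4 * r powr s)"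
    using emeasure_superlevel_le[OF u_meas p_pos t _ u_int]
      emeasure_superlevel_le[OF g_meas p_pos t _ g_int] K_pos unfolding level by auto
  let ?Bad = "{x \<in> space M. t < \<bar>u x\<bar>} \<union> {x \<in> space M. t < \<bar>g x\<bar>} \<union> E"
  have sets: "{x \<in> space M. t < \<bar>u x\<bar>} \<in> sets M" "{x \<in> space M. t < \<bar>g x\<bar>} \<in> sets M"
    using u_meas g_meas by measurable
  have "emeasure M ?Bad = emeasure M ({x \<in> space M. t < \<bar>u x\<bar>} \<union> {x \<in> space M. t < \<bar>g x\<bar>})"
    using E_null sets by (intro emeasure_Un_null_set) auto
  also have "\<dots> \<le> ennreal (b / 4 * r powr s) + ennreal (b / 4 * r powr s)"
    by (intro order.trans[OF emeasure_subadditive] add_mono sets u_bad g_bad)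
  also have "\<dots> = ennreal (b / 2 * r powr s)"
    using b_pos by (simp add: ennreal_plus[symmetric] del: ennreal_plus)
  also have "\<dots> < ennreal (b * r powr s)"
    using b_pos r by (simp add: ennreal_less_iff)
  also have "\<dots> \<le> emeasure M (qball (space M) d x r)" by (rule lower[OF x r])
  finally have "\<not> emeasure M (qball (space M) d x r) \<le> emeasure M ?Bad" by (simp add: not_le)
  then have "\<not> qball (space M) d x r \<subseteq> ?Bad"
    using emeasure_mono[of "qball (space M) d x r" ?Bad M] sets E_null by blast
  then obtain y where "y \<in> qball (space M) d x r" "y \<notin> ?Bad" by blast
  then have "y \<in> qball (space M) d x r" "y \<notin> E" "g y \<le> t" "\<bar>u y\<bar> \<le> t"
    by (auto simp: qball_def)
  then show ?thesis using that by (simp add: t_def r_def)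
qed

definition pt where
  "pt x j = (SOME y. y \<in> qball (space M) d x ((1 / 2) ^ j) \<and> y \<notin> E \<and>
     g y \<le> K * A * L ^ j \<and> \<bar>u y\<bar> \<le> K * A * L ^ j)"

lemma pt:
  assumes "x \<in> space M"
  shows "pt x j \<in> qball (space M) d x ((1 / 2) ^ j)" "pt x j \<notin> E"
    "g (pt x j) \<le> K * A * L ^ j" "\<bar>u (pt x j)\<bar> \<le> K * A * L ^ j"
    "pt x j \<in> space M" "d x (pt x j) < (1 / 2) ^ j"
proof -
  have "\<exists>y. y \<in> qball (space M) d x ((1 / 2) ^ j) \<and> y \<notin> E \<and>
     g y \<le> K * A * L ^ j \<and> \<bar>u y\<bar> \<le> K * A * L ^ j"
    using good_point[OF assms, of j] by metis
  from someI_ex[OF this] show "pt x j \<in> qball (space M) d x ((1 / 2) ^ j)" "pt x j \<notin> E"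
    "g (pt x j) \<le> K * A * L ^ j" "\<bar>u (pt x j)\<bar> \<le> K * A * L ^ j"
    unfolding pt_def by blast+
  then show "pt x j \<in> space M" "d x (pt x j) < (1 / 2) ^ j" by (auto simp: qball_def)
qed

text \<open>The size bound is that of the next finer scale, so that this applies both to points of equal
  scale and to consecutive ones.\<close>
lemma oscillation:
  assumes "y \<in> space M - E" "y' \<in> space M - E" "d y y' \<le> c\<^sup>2 * (1 / 2) ^ j"
    and "g y \<le> K * A * L ^ Suc j" "g y' \<le> K * A * L ^ Suc j"
  shows "\<bar>u y - u y'\<bar> \<le> K * D * \<theta> ^ j"
proof -
  have "\<bar>u y - u y'\<bar> \<le> d y y' powr \<alpha> * (g y + g y')" by (rule gradient) (use assms in auto)
  also have "\<dots> \<le> (c\<^sup>2 * (1 / 2) ^ j) powr \<alpha> * (2 * (K * A * L ^ Suc j))"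
    using assms alpha_pos nonneg[of y y'] g_nonneg[of y] g_nonneg[of y']
    by (intro mult_mono powr_mono2) auto
  also have "(c\<^sup>2 * (1 / 2) ^ j) powr \<alpha> = c powr (2 * \<alpha>) * (2 powr (- \<alpha>)) ^ j"
  proof -
    have "(c\<^sup>2) powr \<alpha> = (c powr 2) powr \<alpha>" using c_ge1 by simp
    also have "\<dots> = c powr (2 * \<alpha>)" by (rule powr_powr)
    finally show ?thesis using c_ge1 by (simp only: powr_mult half_powr)
  qed
  also have "\<dots> * (2 * (K * A * L ^ Suc j)) = K * D * \<theta> ^ j"
    unfolding \<theta>_power[symmetric] D_def by (simp add: mult_ac)
  finally show ?thesis .
qed

lemma L_power_mono: "K * A * L ^ j \<le> K * A * L ^ Suc j"
  using L_gt1 A_pos K_pos by (intro mult_left_mono power_increasing) auto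

lemma oscillation_consecutive:
  assumes "x \<in> space M"
  shows "\<bar>u (pt x (Suc j)) - u (pt x j)\<bar> \<le> K * D * \<theta> ^ j"
proof (rule oscillation)
  have "(1 / 2 :: real) ^ Suc j \<le> (1 / 2) ^ j" by simp
  then have "d x (pt x (Suc j)) < (1 / 2) ^ j"
    using pt(6)[OF assms, of "Suc j"] by (rule less_le_trans[rotated])
  then have "pt x (Suc j) \<in> qball (space M) d x ((1 / 2) ^ j)"
    using pt(5)[OF assms, of "Suc j"] by (simp add: qball_def)
  then show "d (pt x (Suc j)) (pt x j) \<le> c\<^sup>2 * (1 / 2) ^ j"
    by (intro less_imp_le near_common_center[OF assms] pt assms)
  show "g (pt x j) \<le> K * A * L ^ Suc j"
    using pt(3)[OF assms, of j] L_power_mono[of j] by linarith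
qed (use pt[OF assms] in blast)+

text \<open>Passing from one point to the other through both centers, every step costs one factor \<open>c\<close>, and
  the ultrametric form of the triangle inequality keeps the total at \<open>c\<^sup>2\<close>.\<close>
lemma oscillation_nearby:
  assumes x: "x \<in> space M" and y: "y \<in> space M" and xy: "d x y < (1 / 2) ^ j"
  shows "\<bar>u (pt x j) - u (pt y j)\<bar> \<le> K * D * \<theta> ^ j"
proof (rule oscillation)
  let ?r = "(1 / 2 :: real) ^ j"
  have "d (pt x j) x \<le> c * d x (pt x j)" using sym[OF x pt(5)[OF x]] .
  also have "\<dots> \<le> c * ?r" using pt(6)[OF x, of j] c_ge1 by (intro mult_left_mono) auto
  finally have 1: "d (pt x j) x \<le> c * ?r" .
  have "d x (pt y j) \<le> c * max (d x y) (d y (pt y j))" by (rule tri[OF x pt(5)[OF y] y])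
  also have "\<dots> \<le> c * ?r" using pt(6)[OF y, of j] c_ge1 xy by (intro mult_left_mono) auto
  finally have 2: "d x (pt y j) \<le> c * ?r" .
  have "d (pt x j) (pt y j) \<le> c * max (d (pt x j) x) (d x (pt y j))"
    by (rule tri[OF pt(5)[OF x] pt(5)[OF y] x])
  also have "\<dots> \<le> c * (c * ?r)" using 1 2 c_ge1 by (intro mult_left_mono) auto
  finally show "d (pt x j) (pt y j) \<le> c\<^sup>2 * ?r" by (simp add: power2_eq_square)
  show "g (pt x j) \<le> K * A * L ^ Suc j" "g (pt y j) \<le> K * A * L ^ Suc j"
    using pt(3)[OF x, of j] pt(3)[OF y, of j] L_power_mono[of j] by linarith+
qed (use pt[OF x] pt[OF y] in blast)+

lemma oscillation_chain:
  assumes "x \<in> space M" "i \<le> j"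
  shows "\<bar>u (pt x j) - u (pt x i)\<bar> \<le> K * D * (\<Sum>k=i..<j. \<theta> ^ k)"
  using assms(2)
proof (induction j rule: dec_induct)
  case (step j)
  then show ?case
    using oscillation_consecutive[OF assms(1), of j] by (simp add: distrib_left)
qed simp

lemma oscillation_to_center:
  assumes x: "x \<in> space M" "x \<notin> E"
  shows "\<bar>u x - u (pt x j)\<bar> \<le> (2 powr (- \<alpha>)) ^ j * (g x + K * A * L ^ j)"
proof -
  have "\<bar>u x - u (pt x j)\<bar> \<le> d x (pt x j) powr \<alpha> * (g x + g (pt x j))"
    using x pt[OF x(1)] by (intro gradient) auto
  also have "\<dots> \<le> ((1 / 2) ^ j) powr \<alpha> * (g x + K * A * L ^ j)"
    using pt[OF x(1), of j] alpha_pos nonneg[OF x(1) pt(5)[OF x(1)], of j] g_nonneg[OF x(1)]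
      g_nonneg[OF pt(5)[OF x(1)], of j]
    by (intro mult_mono powr_mono2) auto
  finally show ?thesis by (simp only: half_powr)
qed

text \<open>For \<open>\<theta> < 1\<close> this limit exists at every point of the space, including those of \<open>E\<close>, so
  that the Hoelder estimate holds for all pairs of points.\<close>
definition rep where "rep x = lim (\<lambda>j. u (pt x j))"

definition rep_sup_const :: real where "rep_sup_const = A + D / (1 - \<theta>)"

lemma tail_bound:
  assumes "\<theta> < 1" "x \<in> space M" "i \<le> j"
  shows "\<bar>u (pt x j) - u (pt x i)\<bar> \<le> K * (D / (1 - \<theta>)) * \<theta> ^ i"
proof -
  have "(\<Sum>k=i..<j. \<theta> ^ k) \<le> \<theta> ^ i / (1 - \<theta>)"
  proof -
    have "(\<Sum>k=i..<j. \<theta> ^ k) * (1 - \<theta>) = \<theta> ^ i - \<theta> ^ j"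
      using assms(3)
    proof (induction j rule: dec_induct)
      case (step j)
      then show ?case by (simp add: distrib_right) (simp add: algebra_simps)
    qed simp
    also have "\<dots> \<le> \<theta> ^ i" using \<theta>_pos by simp
    finally show ?thesis using assms(1) by (simp add: field_simps)
  qed
  then have "K * D * (\<Sum>k=i..<j. \<theta> ^ k) \<le> K * D * (\<theta> ^ i / (1 - \<theta>))"
    using K_pos D_pos by (intro mult_left_mono) auto
  then show ?thesis using oscillation_chain[OF assms(2,3)] by simp
qed

lemma tendsto_rep:
  assumes \<theta>: "\<theta> < 1" and x: "x \<in> space M"
  shows "(\<lambda>j. u (pt x j)) \<longlonglongrightarrow> rep x"
proof -
  have lim0: "(\<lambda>i. K * (D / (1 - \<theta>)) * \<theta> ^ i) \<longlonglongrightarrow> 0"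
    using \<theta> \<theta>_pos by (auto intro!: tendsto_eq_intros)
  have "Cauchy (\<lambda>j. u (pt x j))"
  proof (rule metric_CauchyI)
    fix e :: real assume e: "0 < e"
    then have "\<forall>\<^sub>F i in sequentially. K * (D / (1 - \<theta>)) * \<theta> ^ i < e / 2"
      using order_tendstoD(2)[OF lim0, of "e / 2"] by simp
    then obtain i where i: "K * (D / (1 - \<theta>)) * \<theta> ^ i < e / 2"
      by (auto simp: eventually_sequentially)
    show "\<exists>N. \<forall>m\<ge>N. \<forall>n\<ge>N. dist (u (pt x m)) (u (pt x n)) < e"
    proof (intro exI allI impI)
      fix m n assume "i \<le> m" "i \<le> n"
      then show "dist (u (pt x m)) (u (pt x n)) < e"
        using tail_bound[OF \<theta> x, of i m] tail_bound[OF \<theta> x, of i n] i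
        unfolding dist_real_def by linarith
    qed
  qed
  then show ?thesis by (simp add: rep_def Cauchy_convergent_iff convergent_LIMSEQ_iff)
qed

lemma rep_approx:
  assumes \<theta>: "\<theta> < 1" and x: "x \<in> space M"
  shows "\<bar>rep x - u (pt x i)\<bar> \<le> K * (D / (1 - \<theta>)) * \<theta> ^ i"
proof (rule tendsto_upperbound)
  show "(\<lambda>j. \<bar>u (pt x j) - u (pt x i)\<bar>) \<longlonglongrightarrow> \<bar>rep x - u (pt x i)\<bar>"
    by (intro tendsto_intros tendsto_rep assms)
  show "\<forall>\<^sub>F j in sequentially. \<bar>u (pt x j) - u (pt x i)\<bar> \<le> K * (D / (1 - \<theta>)) * \<theta> ^ i"
    using tail_bound[OF \<theta> x, of i] by (auto simp: eventually_sequentially)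
qed simp

text \<open>At a point outside \<open>E\<close> the value \<open>g x\<close> is finite, and the gradient inequality between \<open>x\<close> and
  \<open>pt x j\<close> forces \<open>u (pt x j)\<close> to converge to \<open>u x\<close>.\<close>
lemma rep_eq_u:
  assumes \<theta>: "\<theta> < 1" and x: "x \<in> space M" "x \<notin> E"
  shows "u x = rep x"
proof (rule LIMSEQ_unique[OF _ tendsto_rep[OF \<theta> x(1)]])
  have "0 < \<alpha>" by (rule alpha_pos)
  then have "(2::real) powr (- \<alpha>) < 1" by (simp add: powr_less_one)
  then have "(\<lambda>j. g x * (2 powr (- \<alpha>)) ^ j + K * A * \<theta> ^ j) \<longlonglongrightarrow> 0"
    using \<theta> \<theta>_pos by (auto intro!: tendsto_eq_intros)
  moreover have "\<bar>u (pt x j) - u x\<bar> \<le> g x * (2 powr (- \<alpha>)) ^ j + K * A * \<theta> ^ j" for j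
    using oscillation_to_center[OF x, of j]
    by (simp add: abs_minus_commute algebra_simps \<theta>_power[symmetric])
  ultimately have "(\<lambda>j. u (pt x j) - u x) \<longlonglongrightarrow> 0"
    by (elim Lim_null_comparison[rotated]) (simp add: always_eventually)
  then show "(\<lambda>j. u (pt x j)) \<longlonglongrightarrow> u x" by (rule LIM_zero_cancel)
qed

lemma rep_bounded:
  assumes \<theta>: "\<theta> < 1" and x: "x \<in> space M"
  shows "\<bar>rep x\<bar> \<le> K * rep_sup_const"
  using rep_approx[OF assms, of 0] pt(4)[OF x, of 0] by (simp add: rep_sup_const_def distrib_left)

text \<open>The first term serves pairs at distance at least \<open>1\<close>. In the second, the power of \<open>2\<close> stems from
  comparing a distance with the dyadic scale that is at most twice as large.\<close>
definition rep_holder_const :: real where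
  "rep_holder_const = 2 * rep_sup_const + (D + 2 * (D / (1 - \<theta>))) * 2 powr (\<alpha> - s / p)"

text \<open>Points at distance at least \<open>1\<close> are covered by the supremum bound. Otherwise a dyadic scale
  comparable to the distance is chosen; there the two sequences are close to each other and to their
  limits.\<close>
lemma rep_holder:
  assumes \<theta>: "\<theta> < 1" and x: "x \<in> space M" and y: "y \<in> space M"
  shows "\<bar>rep x - rep y\<bar> \<le> K * rep_holder_const * d x y powr (\<alpha> - s / p)"
proof -
  define \<beta> where "\<beta> = \<alpha> - s / p"
  have \<beta>: "0 < \<beta>" using \<theta> powr_less_cancel_iff[of 2 "s / p - \<alpha>" 0] by (simp add: \<theta>_def \<beta>_def)
  have rep_sup_const: "0 < rep_sup_const" using \<theta> A_pos D_pos by (simp add: rep_sup_const_def add_pos_pos)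
  let ?D = "D + 2 * (D / (1 - \<theta>))"
  have D: "0 < ?D" using \<theta> D_pos by (simp add: add_pos_pos)
  consider "x = y" | "1 \<le> d x y" | "x \<noteq> y" "d x y < 1" by linarith
  then show ?thesis
  proof cases
    case 1
    then have "d x y = 0" using zero_iff[OF x y] by blast
    then show ?thesis using 1 by simp
  next
    case 2
    have "\<bar>rep x - rep y\<bar> \<le> K * (2 * rep_sup_const) * 1"
      using rep_bounded[OF \<theta> x] rep_bounded[OF \<theta> y] by linarith
    also have "\<dots> \<le> K * rep_holder_const * d x y powr \<beta>"
      using 2 rep_sup_const K_pos \<beta> D by (intro mult_mono) (auto simp: rep_holder_const_def ge_one_powr_ge_zero)
    finally show ?thesis by (simp add: \<beta>_def)
  next
    case 3
    then have pos: "0 < d x y" using nonneg[OF x y] zero_iff[OF x y] by linarith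
    obtain n where n: "(1 / 2 :: real) ^ n < d x y" using real_arch_pow_inv[OF pos, of "1 / 2"] by auto
    \<comment> \<open>The scale \<open>j\<close> below satisfies \<open>(1 / 2) ^ Suc j \<le> d x y < (1 / 2) ^ j\<close>.\<close>
    define k where "k = (LEAST n. (1 / 2 :: real) ^ n \<le> d x y)"
    have k: "(1 / 2 :: real) ^ k \<le> d x y" unfolding k_def by (rule LeastI[of _ n]) (use n in simp)
    have "k \<noteq> 0" using k 3 by (intro notI) simp
    then obtain j where j: "k = Suc j" by (cases k) auto
    have xy: "d x y < (1 / 2) ^ j"
      using not_less_Least[of j "\<lambda>n. (1 / 2 :: real) ^ n \<le> d x y"] j by (simp add: k_def)
    have "\<bar>rep x - rep y\<bar> \<le> K * D * \<theta> ^ j + 2 * (K * (D / (1 - \<theta>)) * \<theta> ^ j)"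
      using rep_approx[OF \<theta> x, of j] rep_approx[OF \<theta> y, of j] oscillation_nearby[OF x y xy]
      by linarith
    also have "\<dots> = K * ?D * \<theta> ^ j" by (simp only: distrib_left distrib_right mult_ac)
    also have "\<theta> ^ j = ((1 / 2) ^ j) powr \<beta>"
      by (simp add: \<theta>_def \<beta>_def powr_power powr_divide powr_realpow[symmetric] powr_powr
          powr_minus_divide[symmetric] power_one_over algebra_simps)
    also have "\<dots> \<le> (2 * d x y) powr \<beta>"
      using k j \<beta> by (intro powr_mono2) auto
    also have "\<dots> = 2 powr \<beta> * d x y powr \<beta>" using pos by (simp add: powr_mult)
    finally have "\<bar>rep x - rep y\<bar> \<le> K * (?D * 2 powr \<beta>) * d x y powr \<beta>"
      using K_pos D by (simp add: mult_ac mult_left_mono)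
    also have "\<dots> \<le> K * rep_holder_const * d x y powr \<beta>"
      using rep_sup_const K_pos by (intro mult_right_mono mult_left_mono) (auto simp: rep_holder_const_def \<beta>_def)
    finally show ?thesis by (simp add: \<beta>_def)
  qed
qed

text \<open>In units of \<open>K * \<theta> ^ j\<close>, these are the contributions of the first point of the sequence, of
  the step from the \<open>j\<close>-th point to the center, and of the steps in between.\<close>
definition sobolev_factor :: real where "sobolev_factor = A * (L + 2) + D / (\<theta> - 1)"

text \<open>The sequence of points is followed up to the scale \<open>j\<close> with
  \<open>L ^ j \<le> max (g x / (K * A)) 1 < L ^ Suc j\<close>, at which the gradient at \<open>x\<close> itself is admissible up
  to one factor \<open>L\<close>.
  Since \<open>\<theta> > 1\<close>, all contributions are at most a multiple of \<open>\<theta> ^ j\<close>, and \<open>\<theta>\<close> is the power of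
  \<open>L\<close> with exponent \<open>1 - \<alpha> * p / s\<close>.\<close>
lemma pointwise_bound:
  assumes \<theta>: "1 < \<theta>" and x: "x \<in> space M" "x \<notin> E"
  shows "\<bar>u x\<bar> \<le> K * sobolev_factor * (max (g x / (K * A)) 1) powr (1 - \<alpha> * p / s)"
proof -
  define m where "m = max (g x / (K * A)) 1"
  define k where "k = (LEAST n. m < L ^ n)"
  have KA: "0 < K * A" using K_pos A_pos by simp
  obtain n where "m < L ^ n" using real_arch_pow[OF L_gt1] by blast
  then have k: "m < L ^ k" unfolding k_def by (rule LeastI)
  have "k \<noteq> 0" using k by (intro notI) (simp add: m_def)
  then obtain j where j: "k = Suc j" by (cases k) auto
  have m: "L ^ j \<le> m" using not_less_Least[of j "\<lambda>n. m < L ^ n"] j by (simp add: k_def)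
  have "g x \<le> K * A * L ^ Suc j"
  proof -
    have "g x / (K * A) \<le> L ^ Suc j" using k j by (simp add: m_def)
    then show ?thesis using KA by (simp add: field_simps)
  qed
  then have "\<bar>u x - u (pt x j)\<bar> \<le> (2 powr (- \<alpha>)) ^ j * (K * A * L ^ Suc j + K * A * L ^ j)"
    by (intro order.trans[OF oscillation_to_center[OF x]] mult_left_mono) auto
  also have "\<dots> = K * (A * (L + 1)) * \<theta> ^ j"
    by (simp add: \<theta>_power[symmetric] algebra_simps)
  finally have 1: "\<bar>u x - u (pt x j)\<bar> \<le> K * (A * (L + 1)) * \<theta> ^ j" .
  have "(\<Sum>k=0..<j. \<theta> ^ k) \<le> \<theta> ^ j / (\<theta> - 1)"
    using \<theta> geometric_sum[of \<theta> j] by (simp add: atLeast0LessThan divide_right_mono)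
  then have "K * D * (\<Sum>k=0..<j. \<theta> ^ k) \<le> K * D * (\<theta> ^ j / (\<theta> - 1))"
    using K_pos D_pos by (intro mult_left_mono) auto
  then have 2: "\<bar>u (pt x j) - u (pt x 0)\<bar> \<le> K * (D / (\<theta> - 1)) * \<theta> ^ j"
    using oscillation_chain[OF x(1), of 0 j] by simp
  have "K * A * 1 \<le> K * A * \<theta> ^ j" using KA \<theta> by (intro mult_left_mono) auto
  then have 3: "\<bar>u (pt x 0)\<bar> \<le> K * A * \<theta> ^ j" using pt(4)[OF x(1), of 0] by simp
  have "\<bar>u x\<bar> \<le> K * sobolev_factor * \<theta> ^ j"
    using 1 2 3 by (simp add: sobolev_factor_def algebra_simps)
  also have "\<dots> \<le> K * sobolev_factor * m powr (1 - \<alpha> * p / s)"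
  proof (intro mult_left_mono)
    have base: "L powr (1 - \<alpha> * p / s) = \<theta>"
      unfolding L_def \<theta>_def powr_powr using s_pos p_pos
      by (intro arg_cong[where f = "\<lambda>e. 2 powr e"]) (simp add: field_simps)
    have "(L ^ j) powr (1 - \<alpha> * p / s) = (L powr real j) powr (1 - \<alpha> * p / s)"
      using L_gt1 by (simp add: powr_realpow)
    also have "\<dots> = (L powr (1 - \<alpha> * p / s)) ^ j"
      using L_gt1 by (simp add: powr_powr powr_power)
    finally have "\<theta> ^ j = (L ^ j) powr (1 - \<alpha> * p / s)" by (simp only: base)
    moreover have "s / p - \<alpha> > 0" using \<theta> powr_less_cancel_iff[of 2 0 "s / p - \<alpha>"] by (simp add: \<theta>_def)
    then have "0 \<le> 1 - \<alpha> * p / s" using s_pos p_pos by (simp add: field_simps)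
    ultimately show "\<theta> ^ j \<le> m powr (1 - \<alpha> * p / s)"
      using m L_gt1 by (auto intro!: powr_mono2)
    show "0 \<le> K * sobolev_factor" using K_pos A_pos L_gt1 D_pos \<theta> by (simp add: sobolev_factor_def)
  qed
  finally show ?thesis by (simp add: m_def)
qed

text \<open>The exponent \<open>Q\<close> is the one for which the power \<open>1 - \<alpha> * p / s\<close> of \<open>g\<close> in the pointwise bound
  becomes \<open>p\<close>.\<close>
lemma sobolev_bound:
  assumes "\<alpha> * p < s"
  defines "Q \<equiv> s * p / (s - \<alpha> * p)"
  shows "(\<integral>\<^sup>+x. ennreal (\<bar>u x\<bar> powr Q) \<partial>M) \<le>
    ennreal ((K * (sobolev_factor * (measure M (space M) + b / 4) powr (1 / Q))) powr Q)"
proof -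
  have Q: "0 < Q" using assms s_pos p_pos by (simp add: Q_def)
  have \<theta>: "1 < \<theta>" using assms p_pos powr_less_cancel_iff[of 2 0 "s / p - \<alpha>"] by (simp add: \<theta>_def field_simps)
  have KA: "0 < K * A" using K_pos A_pos by simp
  have sobolev_factor: "0 < sobolev_factor" using A_pos L_gt1 D_pos \<theta> by (simp add: sobolev_factor_def add_pos_pos)
  have exponent: "(1 - \<alpha> * p / s) * Q = p" using assms s_pos by (simp add: Q_def field_simps)
  let ?C = "(K * sobolev_factor) powr Q"
  have "AE x in M. x \<notin> E" by (rule AE_not_in[OF E_null])
  then have "(\<integral>\<^sup>+x. ennreal (\<bar>u x\<bar> powr Q) \<partial>M) \<le>
      (\<integral>\<^sup>+x. ennreal ?C * (1 + ennreal ((K * A) powr (- p)) * ennreal (\<bar>g x\<bar> powr p)) \<partial>M)"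
  proof (intro nn_integral_mono_AE, elim AE_mp, intro AE_I2 impI)
    fix x assume x: "x \<in> space M" "x \<notin> E"
    have "\<bar>u x\<bar> powr Q \<le> (K * sobolev_factor * max (g x / (K * A)) 1 powr (1 - \<alpha> * p / s)) powr Q"
      using pointwise_bound[OF \<theta> x] Q by (intro powr_mono2) auto
    also have "\<dots> = ?C * max (g x / (K * A)) 1 powr p"
      using K_pos sobolev_factor by (simp add: powr_mult powr_powr exponent)
    also have "\<dots> \<le> ?C * (1 + (K * A) powr (- p) * \<bar>g x\<bar> powr p)"
    proof (intro mult_left_mono)
      have "(g x / (K * A)) powr p = (K * A) powr (- p) * \<bar>g x\<bar> powr p"
        using KA g_nonneg[OF x(1)] by (simp add: powr_divide powr_minus field_simps)
      then show "max (g x / (K * A)) 1 powr p \<le> 1 + (K * A) powr (- p) * \<bar>g x\<bar> powr p"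
        by (auto simp: max_def)
    qed simp
    finally have "ennreal (\<bar>u x\<bar> powr Q) \<le> ennreal (?C * (1 + (K * A) powr (- p) * \<bar>g x\<bar> powr p))"
      by (rule ennreal_leI)
    then show "ennreal (\<bar>u x\<bar> powr Q) \<le>
        ennreal ?C * (1 + ennreal ((K * A) powr (- p)) * ennreal (\<bar>g x\<bar> powr p))"
      by (simp add: ennreal_mult ennreal_plus)
  qed
  also have "\<dots> = ennreal ?C * (emeasure M (space M) +
      ennreal ((K * A) powr (- p)) * (\<integral>\<^sup>+x. ennreal (\<bar>g x\<bar> powr p) \<partial>M))"
    using g_meas by (simp add: nn_integral_cmult nn_integral_add)
  also have "\<dots> \<le> ennreal ?C * (ennreal (measure M (space M)) +
      ennreal ((K * A) powr (- p)) * ennreal (K powr p))"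
    by (intro mult_left_mono add_mono g_int) (auto simp: emeasure_eq_measure)
  also have "\<dots> = ennreal (?C * (measure M (space M) + (K * A) powr (- p) * K powr p))"
    by (simp add: ennreal_mult ennreal_plus)
  also have "(K * A) powr (- p) * K powr p = b / 4"
    using K_pos A_pos b_pos p_pos by (simp add: powr_mult powr_minus A_def powr_powr field_simps)
  also have "?C * (measure M (space M) + b / 4) =
      (K * (sobolev_factor * (measure M (space M) + b / 4) powr (1 / Q))) powr Q"
    using K_pos sobolev_factor Q b_pos by (simp add: powr_mult powr_powr add_nonneg_pos)
  finally show ?thesis .
qed

end

section \<open>Embeddings into Lebesgue spaces\<close>

lemma continuous_embedding_LpI:
  fixes M :: "'a measure"
  assumes Q: "0 < Q" and C: "0 \<le> C"
    and bound: "\<And>u K. \<lbrakk>u \<in> hajlasz_space M d \<alpha> p; 0 < K; hajlasz_norm M d \<alpha> p u < ennreal K\<rbrakk> \<Longrightarrow>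
      Lp_norm M Q u \<le> ennreal (C * K)"
  shows "continuous_embedding M (hajlasz_space M d \<alpha> p) (hajlasz_norm M d \<alpha> p)
    (Lp_space M Q) (Lp_norm M Q)"
proof -
  let ?N = "hajlasz_norm M d \<alpha> p"
  have est: "Lp_norm M Q u \<le> ennreal C * ?N u" if u: "u \<in> hajlasz_space M d \<alpha> p" for u
  proof (rule norm_bound_from_strict[OF _ C])
    show "?N u < \<infinity>" using u by (simp add: hajlasz_space_def)
    fix K assume K: "?N u < ennreal K"
    then have "0 < K" by (rule ennreal_less_imp_pos)
    then show "Lp_norm M Q u \<le> ennreal (C * K)" using bound[OF u _ K] by blast
  qed
  show ?thesis
    unfolding continuous_embedding_def
  proof (intro conjI ballI impI)
    fix u assume u: "u \<in> hajlasz_space M d \<alpha> p"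
    have "ennreal C * ?N u < \<infinity>"
      using u by (auto simp: hajlasz_space_def ennreal_mult_less_top less_top)
    then have "u \<in> Lp_space M Q"
      using u est[OF u] unfolding hajlasz_space_def Lp_space_def by (auto intro: le_less_trans)
    then show "\<exists>v\<in>Lp_space M Q. AE x in M. u x = v x" by (intro bexI[of _ u]) auto
  next
    fix u v w :: "'a \<Rightarrow> real" assume "AE x in M. u x = v x" "AE x in M. u x = w x"
    then have "AE x in M. v x - w x = 0" by eventually_elim simp
    from Lp_norm_cong_AE[OF this] show "Lp_norm M Q (\<lambda>x. v x - w x) = 0"
      using Q by (simp add: Lp_norm_def)
  next
    show "\<exists>C::real. \<forall>u\<in>hajlasz_space M d \<alpha> p. \<forall>v\<in>Lp_space M Q.
        (AE x in M. u x = v x) \<longrightarrow> Lp_norm M Q v \<le> ennreal C * ?N u"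
      using est Lp_norm_cong_AE[of _ _ M Q] by (intro exI[of _ C]) force
  qed
qed

lemma (in finite_measure) Lp_norm_le_higher_exponent:
  assumes u: "u \<in> borel_measurable M" and q: "0 < q" "q \<le> Q" and R: "0 < R"
    and uQ: "Lp_norm M Q u \<le> ennreal R"
  shows "Lp_norm M q u \<le> ennreal (R * (1 + measure M (space M)) powr (1 / q))"
proof -
  have Q: "0 < Q" using q by simp
  have int: "(\<integral>\<^sup>+x. ennreal (\<bar>u x\<bar> powr Q) \<partial>M) \<le> ennreal (R powr Q)"
    using uQ Lp_norm_le_iff[OF Q less_imp_le[OF R], of M u] by blast
  have "(\<integral>\<^sup>+x. ennreal (\<bar>u x\<bar> powr q) \<partial>M) \<le>
      (\<integral>\<^sup>+x. ennreal (R powr (q - Q)) * ennreal (\<bar>u x\<bar> powr Q) + ennreal (R powr q) \<partial>M)"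
    using powr_le_interpolate[OF q R]
    by (intro nn_integral_mono)
      (simp add: ennreal_mult[symmetric] ennreal_plus[symmetric] del: ennreal_plus)
  also have "\<dots> = ennreal (R powr (q - Q)) * (\<integral>\<^sup>+x. ennreal (\<bar>u x\<bar> powr Q) \<partial>M) +
      ennreal (R powr q) * emeasure M (space M)"
    using u by (simp add: nn_integral_add nn_integral_cmult)
  also have "\<dots> \<le> ennreal (R powr (q - Q)) * ennreal (R powr Q) +
      ennreal (R powr q) * ennreal (measure M (space M))"
    by (intro add_mono mult_left_mono int) (auto simp: emeasure_eq_measure)
  also have "\<dots> = ennreal (R powr q * (1 + measure M (space M)))"
    using R by (simp add: ennreal_mult[symmetric] ennreal_plus[symmetric] powr_add[symmetric]
        distrib_left del: ennreal_plus)
  also have "R powr q * (1 + measure M (space M)) =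
      (R * (1 + measure M (space M)) powr (1 / q)) powr q"
    using R q by (simp add: powr_mult powr_powr)
  finally show ?thesis
    using Lp_norm_le_iff[OF q(1), of "R * (1 + measure M (space M)) powr (1 / q)" M u] R by simp
qed

lemma nn_integral_diff_powr_le:
  assumes v: "v \<in> borel_measurable M" and w: "w \<in> borel_measurable M" and Q: "0 < Q" "0 \<le> R"
    and "Lp_norm M Q v \<le> ennreal R" "Lp_norm M Q w \<le> ennreal R"
  shows "(\<integral>\<^sup>+x. ennreal (\<bar>v x - w x\<bar> powr Q) \<partial>M) \<le> ennreal (2 powr Q * (2 * R powr Q))"
proof -
  have int: "(\<integral>\<^sup>+x. ennreal (\<bar>v x\<bar> powr Q) \<partial>M) \<le> ennreal (R powr Q)"
    "(\<integral>\<^sup>+x. ennreal (\<bar>w x\<bar> powr Q) \<partial>M) \<le> ennreal (R powr Q)"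
    using assms(5,6) Lp_norm_le_iff[OF Q, of M v] Lp_norm_le_iff[OF Q, of M w] by blast+
  have "\<bar>v x - w x\<bar> powr Q \<le> 2 powr Q * (\<bar>v x\<bar> powr Q + \<bar>w x\<bar> powr Q)" for x
  proof -
    have "\<bar>v x - w x\<bar> powr Q \<le> (2 * max \<bar>v x\<bar> \<bar>w x\<bar>) powr Q"
      using Q by (intro powr_mono2) auto
    also have "\<dots> = 2 powr Q * max \<bar>v x\<bar> \<bar>w x\<bar> powr Q" by (simp add: powr_mult)
    also have "\<dots> \<le> 2 powr Q * (\<bar>v x\<bar> powr Q + \<bar>w x\<bar> powr Q)"
      by (intro mult_left_mono) (auto simp: max_def)
    finally show ?thesis .
  qed
  then have "(\<integral>\<^sup>+x. ennreal (\<bar>v x - w x\<bar> powr Q) \<partial>M) \<le>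
      (\<integral>\<^sup>+x. ennreal (2 powr Q) * (ennreal (\<bar>v x\<bar> powr Q) + ennreal (\<bar>w x\<bar> powr Q)) \<partial>M)"
    by (intro nn_integral_mono)
      (simp add: ennreal_mult[symmetric] ennreal_plus[symmetric] del: ennreal_plus)
  also have "\<dots> = ennreal (2 powr Q) * ((\<integral>\<^sup>+x. ennreal (\<bar>v x\<bar> powr Q) \<partial>M) +
      (\<integral>\<^sup>+x. ennreal (\<bar>w x\<bar> powr Q) \<partial>M))"
    using v w by (simp add: nn_integral_add nn_integral_cmult)
  also have "\<dots> \<le> ennreal (2 powr Q) * (ennreal (R powr Q) + ennreal (R powr Q))"
    by (intro mult_left_mono add_mono int) simp
  also have "\<dots> = ennreal (2 powr Q * (2 * R powr Q))"
    by (simp add: ennreal_mult[symmetric] ennreal_plus[symmetric] del: ennreal_plus)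
  finally show ?thesis .
qed

context ahlfors_space
begin

text \<open>The gradients need not be bounded, so values at the nodes of a net do not control the functions
  everywhere. For each function a set \<open>good v\<close> of almost full measure is kept on which
  function and gradient are at most \<open>\<Lambda>\<close>. The label records, for each ball of the net that meets
  \<open>good v\<close>, a rounded value of \<open>v\<close> at some point of the intersection; the point may depend on \<open>v\<close>.
  Functions with equal labels are within \<open>e\<close> of each other on the intersection of their good sets. On
  the complement, whose measure is small, the bound in the higher Lebesgue space is used.

  The constants are fixed in the following order, each making one of three contributions at most a
  third of the admissible total \<open>(\<epsilon> / 2) powr q\<close>: the height \<open>R\<^sub>0\<close> at which powers are interpolated,
  the threshold \<open>\<Lambda>\<close> of the good sets, the accuracy \<open>e\<close>. The radius \<open>r\<close> of the net depends on \<open>\<Lambda>\<close>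
  and \<open>e\<close> and is chosen last.\<close>
lemma totally_bounded_Lp:
  assumes p: "0 < p" and \<alpha>: "0 < \<alpha>" and K: "0 < K" and q: "0 < q" "q < Q" and R: "0 < R"
    and wit: "\<And>v. v \<in> T \<Longrightarrow> \<exists>g E. hajlasz_witness M d \<alpha> p K v g E"
    and TQ: "\<And>v. v \<in> T \<Longrightarrow> Lp_norm M Q v \<le> ennreal R"
  shows "totally_bounded_norm (Lp_norm M q) T"
proof (rule totally_bounded_normI)
  fix \<epsilon> :: real assume \<epsilon>: "0 < \<epsilon>"
  obtain G E where GE: "\<And>v. v \<in> T \<Longrightarrow> hajlasz_witness M d \<alpha> p K v (G v) (E v)"
    using wit by metis
  define \<mu> where "\<mu> = measure M (space M)"
  define W where "W = 2 powr Q * (2 * R powr Q)"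
  define \<eta> where "\<eta> = (\<epsilon> / 2) powr q / 3"
  have \<eta>: "0 < \<eta>" using \<epsilon> by (simp add: \<eta>_def)
  obtain h where h: "0 < h" "W * h powr (Q - q) \<le> \<eta>"
    using exists_small_powr[of W \<eta> "Q - q"] \<eta> q by (auto simp: W_def)
  define R\<^sub>0 where "R\<^sub>0 = 1 / h"
  have R0: "0 < R\<^sub>0" "R\<^sub>0 powr (q - Q) * W \<le> \<eta>"
  proof -
    show "0 < R\<^sub>0" using h by (simp add: R\<^sub>0_def)
    have "R\<^sub>0 powr (q - Q) = h powr (Q - q)"
      using h powr_minus_divide[of h "q - Q"] by (simp add: R\<^sub>0_def powr_divide)
    then show "R\<^sub>0 powr (q - Q) * W \<le> \<eta>" using h by (simp add: mult.commute)
  qed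
  obtain l where l: "0 < l" "(R\<^sub>0 powr q * (4 * K powr p)) * l powr p \<le> \<eta>"
    using exists_small_powr[of "R\<^sub>0 powr q * (4 * K powr p)" \<eta> p] \<eta> p by auto
  define \<Lambda> where "\<Lambda> = 1 / l"
  have \<Lambda>: "0 < \<Lambda>" "R\<^sub>0 powr q * (4 * (K / \<Lambda>) powr p) \<le> \<eta>"
    using l K by (auto simp: \<Lambda>_def powr_mult)
  obtain e where e: "0 < e" "\<mu> * e powr q \<le> \<eta>"
    using exists_small_powr[of \<mu> \<eta> q] \<eta> q by (auto simp: \<mu>_def)
  define \<delta> where "\<delta> = e / 2"
  have \<delta>: "0 < \<delta>" using e by (simp add: \<delta>_def)
  obtain \<rho> where \<rho>: "0 < \<rho>" "4 * \<Lambda> * \<rho> powr \<alpha> \<le> \<delta>"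
    using exists_small_powr[of "4 * \<Lambda>" \<delta> \<alpha>] \<delta> \<alpha> \<Lambda> by auto
  define r where "r = \<rho> / c\<^sup>2"
  have r: "0 < r" "c\<^sup>2 * r = \<rho>" using \<rho> c_ge1 by (auto simp: r_def)
  obtain F where F: "finite F" "F \<subseteq> space M" "space M \<subseteq> (\<Union>i\<in>F. qball (space M) d i r)"
    using finite_net[OF r(1)] by blast
  define good where "good v = {x \<in> space M - E v. G v x \<le> \<Lambda> \<and> \<bar>v x\<bar> \<le> \<Lambda>}" for v
  define pt where "pt v i = (SOME x. x \<in> good v \<inter> qball (space M) d i r)" for v i
  define label where "label v i = (if i \<in> F \<and> good v \<inter> qball (space M) d i r \<noteq> {}
      then Some \<lfloor>v (pt v i) / \<delta>\<rfloor> else None)" for v i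
  have pt: "pt v i \<in> good v" "pt v i \<in> qball (space M) d i r"
    if "good v \<inter> qball (space M) d i r \<noteq> {}" for v i
    using that some_in_eq[of "good v \<inter> qball (space M) d i r"] unfolding pt_def by blast+
  have fin: "finite (label ` T)"
  proof (rule finite_labels[OF F(1)])
    show "finite (insert None (Some ` {\<lfloor>- \<Lambda> / \<delta>\<rfloor>..\<lfloor>\<Lambda> / \<delta>\<rfloor>}))" by simp
    fix v i assume "v \<in> T" "i \<in> F"
    show "label v i \<in> insert None (Some ` {\<lfloor>- \<Lambda> / \<delta>\<rfloor>..\<lfloor>\<Lambda> / \<delta>\<rfloor>})"
    proof (cases "good v \<inter> qball (space M) d i r = {}")
      case False
      then have "\<bar>v (pt v i)\<bar> \<le> \<Lambda>" using pt(1)[OF False] by (simp add: good_def)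
      from floor_label_range[OF this \<delta>] show ?thesis by (simp add: label_def)
    qed (simp add: label_def)
  qed (simp add: label_def)
  have near: "\<bar>v x - v (pt v i)\<bar> \<le> \<delta> / 2"
    if "v \<in> T" "x \<in> good v" "x \<in> qball (space M) d i r" "i \<in> F" for v x i
  proof -
    have ne: "good v \<inter> qball (space M) d i r \<noteq> {}" using that by blast
    have i: "i \<in> space M" using that F by blast
    have sp: "x \<in> space M - E v" "pt v i \<in> space M - E v"
      using that pt(1)[OF ne] by (auto simp: good_def)
    have wv: "hajlasz_witness M d \<alpha> p K v (G v) (E v)" by (rule GE[OF that(1)])
    have "\<bar>v x - v (pt v i)\<bar> \<le> d x (pt v i) powr \<alpha> * (G v x + G v (pt v i))"
      using wv sp unfolding hajlasz_witness_def by blast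
    also have "\<dots> \<le> \<rho> powr \<alpha> * (\<Lambda> + \<Lambda>)"
    proof (intro mult_mono powr_mono2 add_mono)
      show "d x (pt v i) \<le> \<rho>"
        using near_common_center[OF i that(3) pt(2)[OF ne]] r by simp
      show "0 \<le> G v x + G v (pt v i)"
        using wv sp unfolding hajlasz_witness_def by (auto intro!: add_nonneg_nonneg)
    qed (use that pt(1)[OF ne] sp \<alpha> nonneg in \<open>auto simp: good_def\<close>)
    also have "\<dots> \<le> \<delta> / 2" using \<rho>(2) by (simp add: mult_ac)
    finally show ?thesis .
  qed
  have close: "\<bar>v x - w x\<bar> \<le> e"
    if vw: "v \<in> T" "w \<in> T" "label v = label w" and x: "x \<in> good v" "x \<in> good w" for v w x
  proof -
    have "x \<in> space M" using x by (simp add: good_def)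
    then obtain i where i: "i \<in> F" "x \<in> qball (space M) d i r" using F by blast
    have "good v \<inter> qball (space M) d i r \<noteq> {}" "good w \<inter> qball (space M) d i r \<noteq> {}"
      using x i by blast+
    then have "\<lfloor>v (pt v i) / \<delta>\<rfloor> = \<lfloor>w (pt w i) / \<delta>\<rfloor>"
      using i(1) fun_cong[OF vw(3), of i] by (simp add: label_def)
    from floor_label_close[OF this \<delta>] have "\<bar>v (pt v i) - w (pt w i)\<bar> \<le> \<delta>" .
    then show ?thesis
      using near[OF vw(1) x(1) i(2,1)] near[OF vw(2) x(2) i(2,1)] unfolding \<delta>_def by linarith
  qed
  have meas: "v \<in> borel_measurable M" "G v \<in> borel_measurable M" "E v \<in> null_sets M"
    if "v \<in> T" for v
    using GE[OF that] by (auto simp: hajlasz_witness_def)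
  have good_sets: "good v \<in> sets M" if "v \<in> T" for v
  proof -
    have "{x \<in> space M. G v x \<le> \<Lambda> \<and> \<bar>v x\<bar> \<le> \<Lambda>} \<in> sets M"
      using meas(1,2)[OF that] by measurable
    moreover have "good v = {x \<in> space M. G v x \<le> \<Lambda> \<and> \<bar>v x\<bar> \<le> \<Lambda>} - E v"
      by (auto simp: good_def)
    ultimately show ?thesis using meas(3)[OF that] by auto
  qed
  have bad: "emeasure M (space M - good v) \<le> ennreal (2 * (K / \<Lambda>) powr p)" if v: "v \<in> T" for v
  proof -
    let ?U = "{x \<in> space M. \<Lambda> < \<bar>v x\<bar>}" and ?G = "{x \<in> space M. \<Lambda> < \<bar>G v x\<bar>}"
    have sets: "?U \<in> sets M" "?G \<in> sets M" using meas[OF v] by measurable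
    have "space M - good v \<subseteq> (?U \<union> ?G) \<union> E v" by (auto simp: good_def)
    then have "emeasure M (space M - good v) \<le> emeasure M ((?U \<union> ?G) \<union> E v)"
      using sets meas(3)[OF v] by (intro emeasure_mono) auto
    also have "\<dots> = emeasure M (?U \<union> ?G)"
      using meas(3)[OF v] sets by (intro emeasure_Un_null_set) auto
    also have "\<dots> \<le> ennreal ((K / \<Lambda>) powr p) + ennreal ((K / \<Lambda>) powr p)"
      using GE[OF v] K unfolding hajlasz_witness_def
      by (intro order.trans[OF emeasure_subadditive] add_mono sets
          emeasure_superlevel_le[OF _ p \<Lambda>(1)]) auto
    also have "\<dots> = ennreal (2 * (K / \<Lambda>) powr p)"
      by (simp add: ennreal_plus[symmetric] del: ennreal_plus)
    finally show ?thesis .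
  qed
  have "Lp_norm M q (\<lambda>x. v x - w x) < ennreal \<epsilon>"
    if vw: "v \<in> T" "w \<in> T" "label v = label w" for v w
  proof -
    let ?B = "(space M - good v) \<union> (space M - good w)"
    have B: "?B \<in> sets M" using good_sets[OF vw(1)] good_sets[OF vw(2)] by auto
    have "emeasure M ?B \<le> ennreal (2 * (K / \<Lambda>) powr p) + ennreal (2 * (K / \<Lambda>) powr p)"
      using good_sets[OF vw(1)] good_sets[OF vw(2)]
      by (intro order.trans[OF emeasure_subadditive] add_mono bad vw) auto
    also have "\<dots> = ennreal (4 * (K / \<Lambda>) powr p)"
      by (simp add: ennreal_plus[symmetric] del: ennreal_plus)
    finally have small: "emeasure M ?B \<le> ennreal (4 * (K / \<Lambda>) powr p)" .
    have "(\<integral>\<^sup>+x. ennreal (\<bar>v x - w x\<bar> powr q) \<partial>M) \<le>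
        (\<integral>\<^sup>+x. ennreal (e powr q) + (ennreal (R\<^sub>0 powr (q - Q)) * ennreal (\<bar>v x - w x\<bar> powr Q) +
           ennreal (R\<^sub>0 powr q) * indicator ?B x) \<partial>M)"
    proof (intro nn_integral_mono)
      fix x assume x: "x \<in> space M"
      show "ennreal (\<bar>v x - w x\<bar> powr q) \<le> ennreal (e powr q) +
          (ennreal (R\<^sub>0 powr (q - Q)) * ennreal (\<bar>v x - w x\<bar> powr Q) + ennreal (R\<^sub>0 powr q) * indicator ?B x)"
      proof (cases "x \<in> ?B")
        case True
        have "\<bar>v x - w x\<bar> powr q \<le> R\<^sub>0 powr (q - Q) * \<bar>v x - w x\<bar> powr Q + R\<^sub>0 powr q"
          using q by (intro powr_le_interpolate R0) auto
        then have "ennreal (\<bar>v x - w x\<bar> powr q) \<le>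
            ennreal (R\<^sub>0 powr (q - Q)) * ennreal (\<bar>v x - w x\<bar> powr Q) + ennreal (R\<^sub>0 powr q)"
          by (simp add: ennreal_mult[symmetric] ennreal_plus[symmetric] del: ennreal_plus)
        then show ?thesis using True by (simp add: add_increasing)
      next
        case False
        then have "\<bar>v x - w x\<bar> \<le> e" using x by (intro close[OF vw]) auto
        then have "ennreal (\<bar>v x - w x\<bar> powr q) \<le> ennreal (e powr q)"
          using q by (intro ennreal_leI powr_mono2) auto
        then show ?thesis by (rule order.trans) simp
      qed
    qed
    also have "\<dots> = ennreal (e powr q) * emeasure M (space M) +
        (ennreal (R\<^sub>0 powr (q - Q)) * (\<integral>\<^sup>+x. ennreal (\<bar>v x - w x\<bar> powr Q) \<partial>M) +
         ennreal (R\<^sub>0 powr q) * emeasure M ?B)"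
      using meas(1)[OF vw(1)] meas(1)[OF vw(2)] B
      by (simp add: nn_integral_add nn_integral_cmult)
    also have "\<dots> \<le> ennreal (e powr q) * ennreal \<mu> +
        (ennreal (R\<^sub>0 powr (q - Q)) * ennreal W + ennreal (R\<^sub>0 powr q) * ennreal (4 * (K / \<Lambda>) powr p))"
    proof -
      have "0 < Q" using q by simp
      then have "(\<integral>\<^sup>+x. ennreal (\<bar>v x - w x\<bar> powr Q) \<partial>M) \<le> ennreal W" unfolding W_def
        using meas(1) vw TQ R by (intro nn_integral_diff_powr_le) auto
      then show ?thesis
        by (intro add_mono mult_left_mono small) (auto simp: \<mu>_def emeasure_eq_measure)
    qed
    also have "\<dots> = ennreal (\<mu> * e powr q + (R\<^sub>0 powr (q - Q) * W + R\<^sub>0 powr q * (4 * (K / \<Lambda>) powr p)))"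
      by (simp add: ennreal_mult[symmetric] ennreal_plus[symmetric] W_def \<mu>_def mult.commute
          del: ennreal_plus)
    also have "\<dots> \<le> ennreal ((\<epsilon> / 2) powr q)"
      using e(2) R0(2) \<Lambda>(2) by (intro ennreal_leI) (simp add: \<eta>_def)
    finally have "Lp_norm M q (\<lambda>x. v x - w x) \<le> ennreal (\<epsilon> / 2)"
      using Lp_norm_le_iff[OF q(1), of "\<epsilon> / 2" M] \<epsilon> by simp
    also have "\<dots> < ennreal \<epsilon>" using \<epsilon> by (simp add: ennreal_less_iff)
    finally show ?thesis .
  qed
  with fin show "\<exists>label :: ('a \<Rightarrow> real) \<Rightarrow> 'a \<Rightarrow> int option. finite (label ` T) \<and>
      (\<forall>v\<in>T. \<forall>w\<in>T. label v = label w \<longrightarrow> Lp_norm M q (\<lambda>x. v x - w x) < ennreal \<epsilon>)"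
    by (intro exI[of _ label]) auto
qed

text \<open>Any bound in a higher Lebesgue space suffices, so that both ranges of exponents are covered.\<close>
lemma compact_embedding_Lp:
  assumes p: "0 < p" and \<alpha>: "0 < \<alpha>" and q: "0 < q" "q < Q" and C: "0 < C"
    and bound: "\<And>u K. \<lbrakk>u \<in> hajlasz_space M d \<alpha> p; 0 < K; hajlasz_norm M d \<alpha> p u < ennreal K\<rbrakk> \<Longrightarrow>
      Lp_norm M Q u \<le> ennreal (C * K)"
  shows "compact_embedding M (hajlasz_space M d \<alpha> p) (hajlasz_norm M d \<alpha> p)
    (Lp_space M q) (Lp_norm M q)"
  unfolding compact_embedding_def
proof (intro conjI allI impI)
  let ?c = "(1 + measure M (space M)) powr (1 / q)"
  show "continuous_embedding M (hajlasz_space M d \<alpha> p) (hajlasz_norm M d \<alpha> p)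
    (Lp_space M q) (Lp_norm M q)"
  proof (rule continuous_embedding_LpI[where C = "C * ?c"])
    fix u K assume u: "u \<in> hajlasz_space M d \<alpha> p" "0 < K" "hajlasz_norm M d \<alpha> p u < ennreal K"
    have "u \<in> borel_measurable M" using u by (simp add: hajlasz_space_def Lp_space_def)
    then have "Lp_norm M q u \<le> ennreal (C * K * ?c)"
      using q C u bound[OF u] by (intro Lp_norm_le_higher_exponent) auto
    then show "Lp_norm M q u \<le> ennreal (C * ?c * K)" by (simp add: mult_ac)
  qed (use q C in auto)
next
  fix S assume S: "S \<subseteq> hajlasz_space M d \<alpha> p" "\<exists>K::real. \<forall>u\<in>S. hajlasz_norm M d \<alpha> p u \<le> ennreal K"
  obtain K where K: "0 < K" and less: "\<And>u. u \<in> S \<Longrightarrow> hajlasz_norm M d \<alpha> p u < ennreal K"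
    using bounded_set_uniform_bound[OF S(2)] by blast
  show "totally_bounded_norm (Lp_norm M q) {v \<in> Lp_space M q. \<exists>u\<in>S. AE x in M. u x = v x}"
  proof (rule totally_bounded_Lp[OF p \<alpha> K q])
    show "0 < C * K" using C K by simp
    fix v assume "v \<in> {v \<in> Lp_space M q. \<exists>u\<in>S. AE x in M. u x = v x}"
    then obtain u where v: "v \<in> borel_measurable M" and u: "u \<in> S" "AE x in M. u x = v x"
      by (auto simp: Lp_space_def)
    obtain g E where "hajlasz_witness M d \<alpha> p K u g E"
      using hajlasz_witness_exists[OF _ less p] S u by blast
    from hajlasz_witness_cong_AE[OF this v u(2)]
    show "\<exists>g E. hajlasz_witness M d \<alpha> p K v g E" by blast
    show "Lp_norm M Q v \<le> ennreal (C * K)"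
      using bound[OF _ K less[OF u(1)]] S(1) u(1) Lp_norm_cong_AE[OF u(2)] by auto
  qed
qed

end

section \<open>Embeddings into Hoelder spaces\<close>

lemma holder_norm_le:
  assumes "\<And>x. x \<in> X \<Longrightarrow> \<bar>f x\<bar> \<le> A" "0 \<le> A" "0 \<le> B"
    and "\<And>x y. \<lbrakk>x \<in> X; y \<in> X; x \<noteq> y\<rbrakk> \<Longrightarrow> \<bar>f x - f y\<bar> \<le> B * d x y powr \<gamma>"
  shows "holder_norm X d \<gamma> f \<le> ennreal (A + B)"
proof -
  have "(SUP x\<in>X. ennreal \<bar>f x\<bar>) \<le> ennreal A"
    using assms by (intro SUP_least ennreal_leI) auto
  moreover have "\<bar>f x - f y\<bar> / d x y powr \<gamma> \<le> B" if "x \<in> X" "y \<in> X" "x \<noteq> y" for x y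
  proof (cases "d x y powr \<gamma> = 0")
    case False
    then have "0 < d x y powr \<gamma>" using powr_ge_zero[of "d x y" \<gamma>] by linarith
    then show ?thesis using assms(4)[OF that] by (simp add: divide_le_eq)
  qed (use assms in simp)
  then have "(SUP (x, y)\<in>{(x, y). x \<in> X \<and> y \<in> X \<and> x \<noteq> y}.
      ennreal (\<bar>f x - f y\<bar> / d x y powr \<gamma>)) \<le> ennreal B"
    by (intro SUP_least) (auto intro!: ennreal_leI)
  ultimately have "holder_norm X d \<gamma> f \<le> ennreal A + ennreal B"
    unfolding holder_norm_def by (rule add_mono)
  then show ?thesis using assms by simp
qed

lemma holder_spaceI:
  assumes "\<And>x. x \<in> X \<Longrightarrow> \<bar>f x\<bar> \<le> A" "0 \<le> A" "0 \<le> B"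
    and "\<And>x y. \<lbrakk>x \<in> X; y \<in> X; x \<noteq> y\<rbrakk> \<Longrightarrow> \<bar>f x - f y\<bar> \<le> B * d x y powr \<gamma>"
  shows "f \<in> holder_space X d \<gamma>"
proof -
  have "bounded (f ` X)" using assms(1) by (auto simp: bounded_iff)
  moreover have "holder_norm X d \<gamma> f < \<infinity>"
    using holder_norm_le[of X f A B d \<gamma>] assms by (auto intro: le_less_trans)
  ultimately show ?thesis by (simp add: holder_space_def)
qed

context quasi_metric_measure_space
begin

lemma holder_spaceD:
  assumes "f \<in> holder_space (space M) d \<gamma>"
  obtains B where "0 < B"
    "\<And>x y. \<lbrakk>x \<in> space M; y \<in> space M\<rbrakk> \<Longrightarrow> \<bar>f x - f y\<bar> \<le> B * d x y powr \<gamma>"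
proof -
  let ?P = "{(x, y). x \<in> space M \<and> y \<in> space M \<and> x \<noteq> y}"
  let ?q = "\<lambda>(x, y). ennreal (\<bar>f x - f y\<bar> / d x y powr \<gamma>)"
  have "(SUP xy\<in>?P. ?q xy) \<le> holder_norm (space M) d \<gamma> f" by (simp add: holder_norm_def)
  also have "\<dots> < \<infinity>" using assms by (simp add: holder_space_def)
  finally obtain B where B: "0 \<le> B" "(SUP xy\<in>?P. ?q xy) = ennreal B"
    by (cases "SUP xy\<in>?P. ?q xy") auto
  have "\<bar>f x - f y\<bar> \<le> (B + 1) * d x y powr \<gamma>" if xy: "x \<in> space M" "y \<in> space M" for x y
  proof (cases "x = y")
    case False
    then have pos: "0 < d x y" using nonneg[OF xy] zero_iff[OF xy] by linarith
    have "?q (x, y) \<le> ennreal B" unfolding B(2)[symmetric]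
      using xy False by (intro SUP_upper) auto
    then have "\<bar>f x - f y\<bar> / d x y powr \<gamma> \<le> B" using B(1) by simp
    then have "\<bar>f x - f y\<bar> \<le> B * d x y powr \<gamma>" using pos by (simp add: divide_le_eq)
    also have "\<dots> \<le> (B + 1) * d x y powr \<gamma>" by (intro mult_right_mono) auto
    finally show ?thesis .
  qed (use B in simp)
  then show ?thesis using that[of "B + 1"] B(1) by simp
qed

text \<open>Balls have positive measure, so two functions that agree almost everywhere agree at points
  arbitrarily close to any given one. The exponents may differ because a function in the larger
  Hoelder space has to be identified with a representative of higher regularity.\<close>
lemma holder_eq_if_AE_eq:
  assumes v: "v \<in> holder_space (space M) d \<beta>" "0 < \<beta>"
    and w: "w \<in> holder_space (space M) d \<gamma>" "0 < \<gamma>"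
    and ae: "AE x in M. v x = w x" and x: "x \<in> space M"
  shows "v x = w x"
proof (rule ccontr)
  assume neq: "v x \<noteq> w x"
  define e where "e = \<bar>v x - w x\<bar>"
  have e: "0 < e" using neq by (simp add: e_def)
  obtain B where B: "0 < B" "\<And>y. y \<in> space M \<Longrightarrow> \<bar>v x - v y\<bar> \<le> B * d x y powr \<beta>"
    using holder_spaceD[OF v(1)] x by metis
  obtain B' where B': "0 < B'" "\<And>y. y \<in> space M \<Longrightarrow> \<bar>w x - w y\<bar> \<le> B' * d x y powr \<gamma>"
    using holder_spaceD[OF w(1)] x by metis
  obtain t where t: "0 < t" "B * t powr \<beta> \<le> e / 3"
    using exists_small_powr[of B "e / 3" \<beta>] B(1) e v(2) by auto
  obtain t' where t': "0 < t'" "B' * t' powr \<gamma> \<le> e / 3"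
    using exists_small_powr[of B' "e / 3" \<gamma>] B'(1) e w(2) by auto
  let ?B = "qball (space M) d x (min t t')"
  have ball: "?B \<in> sets M" "0 < emeasure M ?B" using x t(1) t'(1) by (auto intro: ball_sets ball_pos)
  obtain N where N: "N \<in> null_sets M" "{x \<in> space M. v x \<noteq> w x} \<subseteq> N"
    using ae by (auto elim!: AE_E)
  have "\<not> ?B \<subseteq> N"
    using emeasure_mono[of ?B N M] N(1) ball by (auto simp: null_sets_def)
  then obtain y where "y \<in> ?B" "y \<notin> N" by blast
  then have y: "y \<in> space M" "d x y < t" "d x y < t'" "v y = w y"
    using N(2) by (auto simp: qball_def)
  have d: "0 \<le> d x y" using nonneg[OF x y(1)] .
  have "\<bar>v x - v y\<bar> \<le> B * t powr \<beta>"
    using B(1) y(2) d v(2) by (intro order.trans[OF B(2)[OF y(1)]] mult_left_mono powr_mono2) auto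
  moreover have "\<bar>w x - w y\<bar> \<le> B' * t' powr \<gamma>"
    using B'(1) y(3) d w(2) by (intro order.trans[OF B'(2)[OF y(1)]] mult_left_mono powr_mono2) auto
  ultimately have "\<bar>v x - w x\<bar> \<le> 2 * (e / 3)" using t(2) t'(2) y(4) by linarith
  then show False using e by (simp add: e_def)
qed

lemma holder_lower_exponent:
  assumes xy: "x \<in> space M" "y \<in> space M" and \<gamma>: "\<gamma> \<le> \<beta>" "0 < \<gamma>" and R: "0 \<le> R"
    and f: "\<bar>f x\<bar> \<le> R" "\<bar>f y\<bar> \<le> R" "\<bar>f x - f y\<bar> \<le> R * d x y powr \<beta>"
  shows "\<bar>f x - f y\<bar> \<le> 2 * R * d x y powr \<gamma>"
proof (cases "d x y \<le> 1")
  case True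
  have "d x y powr \<beta> \<le> d x y powr \<gamma>"
    using True \<gamma> nonneg[OF xy] by (intro powr_mono') auto
  then have "R * d x y powr \<beta> \<le> R * d x y powr \<gamma>" using R by (rule mult_left_mono)
  also have "\<dots> \<le> 2 * R * d x y powr \<gamma>" using R by simp
  finally show ?thesis using f(3) by linarith
next
  case False
  then have "2 * R * 1 \<le> 2 * R * d x y powr \<gamma>"
    using R \<gamma> by (intro mult_left_mono ge_one_powr_ge_zero) auto
  then show ?thesis using f(1,2) by linarith
qed

end

context ahlfors_space
begin

text \<open>A real-valued bound on both parts of the Hoelder norm is more convenient than the extended norm
  itself.\<close>
definition holder_rep where
  "holder_rep \<beta> R v \<longleftrightarrow> (\<forall>x\<in>space M. \<bar>v x\<bar> \<le> R) \<and>
     (\<forall>x\<in>space M. \<forall>y\<in>space M. \<bar>v x - v y\<bar> \<le> R * d x y powr \<beta>)"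

text \<open>Rounded values at the nodes of a fine net determine a function uniformly up to \<open>\<eta>\<close>. For the
  difference quotient with the smaller exponent \<open>\<gamma>\<close>, pairs at distance at most \<open>t\<close> gain a factor
  \<open>t powr (\<beta> - \<gamma>)\<close> from the Hoelder bound with exponent \<open>\<beta>\<close>, and for the remaining pairs the uniform
  bound \<open>\<eta>\<close> is divided by a power that is at least \<open>t powr \<gamma>\<close>.\<close>
lemma totally_bounded_holder:
  assumes \<gamma>: "0 < \<gamma>" "\<gamma> < \<beta>" and R: "0 \<le> R"
    and T: "\<And>v. v \<in> T \<Longrightarrow> holder_rep \<beta> R v"
  shows "totally_bounded_norm (holder_norm (space M) d \<gamma>) T"
proof (rule totally_bounded_normI)
  fix \<epsilon> :: real assume \<epsilon>: "0 < \<epsilon>"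
  obtain t where t: "0 < t" "(2 * R) * t powr (\<beta> - \<gamma>) \<le> \<epsilon> / 4"
    using exists_small_powr[of "2 * R" "\<epsilon> / 4" "\<beta> - \<gamma>"] R \<epsilon> \<gamma> by auto
  define \<eta> where "\<eta> = min (\<epsilon> / 4) (\<epsilon> / 8 * t powr \<gamma>)"
  have \<eta>: "0 < \<eta>" "\<eta> \<le> \<epsilon> / 4" "2 * \<eta> \<le> \<epsilon> / 4 * t powr \<gamma>" using \<epsilon> t(1) by (auto simp: \<eta>_def)
  define \<delta> where "\<delta> = \<eta> / 2"
  have \<delta>: "0 < \<delta>" using \<eta> by (simp add: \<delta>_def)
  obtain r where r: "0 < r" "(2 * R) * r powr \<beta> \<le> \<eta> / 2"
    using exists_small_powr[of "2 * R" "\<eta> / 2" \<beta>] R \<eta> \<gamma> by auto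
  obtain F where F: "finite F" "F \<subseteq> space M" "space M \<subseteq> (\<Union>i\<in>F. qball (space M) d i r)"
    using finite_net[OF r(1)] by blast
  define label where "label v i = (if i \<in> F then \<lfloor>v i / \<delta>\<rfloor> else 0)" for v :: "'a \<Rightarrow> real" and i
  have fin: "finite (label ` T)"
  proof (rule finite_labels[OF F(1)])
    show "finite {\<lfloor>- R / \<delta>\<rfloor>..\<lfloor>R / \<delta>\<rfloor>}" by simp
    fix v i assume "v \<in> T" "i \<in> F"
    then have "\<bar>v i\<bar> \<le> R" using T F unfolding holder_rep_def by blast
    from floor_label_range[OF this \<delta>] show "label v i \<in> {\<lfloor>- R / \<delta>\<rfloor>..\<lfloor>R / \<delta>\<rfloor>}"
      using \<open>i \<in> F\<close> by (simp add: label_def)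
  qed (simp add: label_def)
  have near: "\<bar>v i - v x\<bar> \<le> R * r powr \<beta>" if "v \<in> T" "i \<in> F" "x \<in> qball (space M) d i r" for v i x
  proof -
    have sp: "i \<in> space M" "x \<in> space M" "d i x < r" using that F by (auto simp: qball_def)
    have "\<bar>v i - v x\<bar> \<le> R * d i x powr \<beta>" using T[OF that(1)] sp unfolding holder_rep_def by blast
    also have "\<dots> \<le> R * r powr \<beta>"
      using R sp \<gamma> nonneg[OF sp(1,2)] by (intro mult_left_mono powr_mono2) auto
    finally show ?thesis .
  qed
  have "holder_norm (space M) d \<gamma> (\<lambda>x. v x - w x) < ennreal \<epsilon>"
    if vw: "v \<in> T" "w \<in> T" "label v = label w" for v w
  proof -
    have sup: "\<bar>v x - w x\<bar> \<le> \<eta>" if x: "x \<in> space M" for x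
    proof -
      obtain i where i: "i \<in> F" "x \<in> qball (space M) d i r" using F x by blast
      have "\<lfloor>v i / \<delta>\<rfloor> = \<lfloor>w i / \<delta>\<rfloor>" using i(1) fun_cong[OF vw(3), of i] by (simp add: label_def)
      from floor_label_close[OF this \<delta>] have "\<bar>v i - w i\<bar> \<le> \<eta> / 2" by (simp add: \<delta>_def)
      then show ?thesis using near[OF vw(1) i] near[OF vw(2) i] r(2) by linarith
    qed
    have "\<bar>(v x - w x) - (v y - w y)\<bar> \<le> \<epsilon> / 4 * d x y powr \<gamma>"
      if xy: "x \<in> space M" "y \<in> space M" for x y
    proof (cases "d x y \<le> t")
      case True
      have "\<bar>v x - v y\<bar> \<le> R * d x y powr \<beta>" "\<bar>w x - w y\<bar> \<le> R * d x y powr \<beta>"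
        using T[OF vw(1)] T[OF vw(2)] xy unfolding holder_rep_def by blast+
      then have "\<bar>(v x - w x) - (v y - w y)\<bar> \<le> (2 * R) * d x y powr \<beta>" by linarith
      also have "\<dots> = (2 * R) * d x y powr (\<beta> - \<gamma>) * d x y powr \<gamma>"
        by (simp add: powr_add[symmetric])
      also have "\<dots> \<le> (2 * R) * t powr (\<beta> - \<gamma>) * d x y powr \<gamma>"
        using R True \<gamma> nonneg[OF xy] by (intro mult_right_mono mult_left_mono powr_mono2) auto
      also have "\<dots> \<le> \<epsilon> / 4 * d x y powr \<gamma>" by (intro mult_right_mono t) simp
      finally show ?thesis .
    next
      case False
      have "\<bar>(v x - w x) - (v y - w y)\<bar> \<le> 2 * \<eta>"
        using sup[OF xy(1)] sup[OF xy(2)] by linarith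
      also have "\<dots> \<le> \<epsilon> / 4 * t powr \<gamma>" by (rule \<eta>(3))
      also have "\<dots> \<le> \<epsilon> / 4 * d x y powr \<gamma>"
        using False t(1) \<gamma> \<epsilon> by (intro mult_left_mono powr_mono2) auto
      finally show ?thesis .
    qed
    then have "holder_norm (space M) d \<gamma> (\<lambda>x. v x - w x) \<le> ennreal (\<eta> + \<epsilon> / 4)"
      using sup \<eta>(1) \<epsilon> by (intro holder_norm_le) auto
    also have "\<dots> < ennreal \<epsilon>" using \<eta>(1,2) \<epsilon> by (intro ennreal_lessI) auto
    finally show ?thesis .
  qed
  with fin show "\<exists>label :: ('a \<Rightarrow> real) \<Rightarrow> 'a \<Rightarrow> int. finite (label ` T) \<and>
      (\<forall>v\<in>T. \<forall>w\<in>T. label v = label w \<longrightarrow> holder_norm (space M) d \<gamma> (\<lambda>x. v x - w x) < ennreal \<epsilon>)"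
    by (intro exI[of _ label]) auto
qed

lemma holder_representative:
  assumes \<alpha>: "0 < \<alpha>" and p: "0 < p" and sup: "s < \<alpha> * p"
  obtains C where "0 < C" "\<And>u K. \<lbrakk>u \<in> hajlasz_space M d \<alpha> p; 0 < K;
      hajlasz_norm M d \<alpha> p u < ennreal K\<rbrakk> \<Longrightarrow>
      \<exists>v. (AE x in M. u x = v x) \<and> holder_rep (\<alpha> - s / p) (C * K) v"
proof -
  define C where "C = max 1 (max (hajlasz_function.rep_sup_const s b c \<alpha> p)
    (hajlasz_function.rep_holder_const s b c \<alpha> p))"
  have "\<exists>v. (AE x in M. u x = v x) \<and> holder_rep (\<alpha> - s / p) (C * K) v"
    if u: "u \<in> hajlasz_space M d \<alpha> p" and K: "0 < K" and less: "hajlasz_norm M d \<alpha> p u < ennreal K"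
    for u K
  proof -
    obtain g E where "hajlasz_witness M d \<alpha> p K u g E"
      using hajlasz_witness_exists[OF u less p] by blast
    then interpret hajlasz_function M d s b c \<alpha> p K u g E
      by unfold_locales (use \<alpha> p K in auto)
    have "s / p - \<alpha> < 0" using sup p by (simp add: field_simps)
    then have \<theta>: "\<theta> < 1" unfolding \<theta>_def by (intro powr_less_one) auto
    have "AE x in M. u x = rep x"
      using AE_not_in[OF E_null] AE_space by eventually_elim (use rep_eq_u[OF \<theta>] in blast)
    moreover have "K * rep_sup_const \<le> C * K" "K * rep_holder_const \<le> C * K"
      using K by (simp_all add: C_def mult.commute)
    then have "holder_rep (\<alpha> - s / p) (C * K) rep"
      unfolding holder_rep_def
      using rep_bounded[OF \<theta>] rep_holder[OF \<theta>]
      by (meson order.trans mult_right_mono powr_ge_zero)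
    ultimately show ?thesis by blast
  qed
  moreover have "0 < C" by (simp add: C_def)
  ultimately show ?thesis using that by blast
qed

lemma sobolev_constant:
  assumes \<alpha>: "0 < \<alpha>" and p: "0 < p" and sub: "\<alpha> * p < s"
  obtains C where "0 < C" "\<And>u K. \<lbrakk>u \<in> hajlasz_space M d \<alpha> p; 0 < K;
      hajlasz_norm M d \<alpha> p u < ennreal K\<rbrakk> \<Longrightarrow>
      Lp_norm M (s * p / (s - \<alpha> * p)) u \<le> ennreal (C * K)"
proof -
  let ?Q = "s * p / (s - \<alpha> * p)"
  have Q: "0 < ?Q" using sub p s_pos by simp
  define C\<^sub>0 where "C\<^sub>0 =
    hajlasz_function.sobolev_factor s b c \<alpha> p * (measure M (space M) + b / 4) powr (1 / ?Q)"
  define C where "C = max 1 C\<^sub>0"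
  have "Lp_norm M ?Q u \<le> ennreal (C * K)"
    if u: "u \<in> hajlasz_space M d \<alpha> p" and K: "0 < K" and less: "hajlasz_norm M d \<alpha> p u < ennreal K"
    for u K
  proof -
    obtain g E where "hajlasz_witness M d \<alpha> p K u g E"
      using hajlasz_witness_exists[OF u less p] by blast
    then interpret hajlasz_function M d s b c \<alpha> p K u g E
      by unfold_locales (use \<alpha> p K in auto)
    have "0 < s / p - \<alpha>" using sub p by (simp add: field_simps)
    then have "1 < \<theta>" by (simp add: \<theta>_def gr_one_powr)
    then have "0 \<le> sobolev_factor" using A_pos L_gt1 D_pos by (simp add: sobolev_factor_def)
    then have "0 \<le> K * C\<^sub>0" using K by (simp add: C\<^sub>0_def)
    then have "Lp_norm M ?Q u \<le> ennreal (K * C\<^sub>0)"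
      using sobolev_bound[OF sub] Lp_norm_le_iff[OF Q, of "K * C\<^sub>0" M u] by (simp only: C\<^sub>0_def)
    also have "\<dots> \<le> ennreal (C * K)"
      using K by (intro ennreal_leI) (simp add: C_def mult.commute)
    finally show ?thesis .
  qed
  moreover have "0 < C" by (simp add: C_def)
  ultimately show ?thesis using that by blast
qed

text \<open>Above the critical exponent \<open>u\<close> is essentially bounded and the total measure is finite, which
  bounds all Lebesgue norms. This is the input for compactness in \<open>L\<^sup>q\<close> with \<open>q\<close> below any chosen
  exponent.\<close>
lemma supercritical_Lp_constant:
  assumes \<alpha>: "0 < \<alpha>" and p: "0 < p" and sup: "s < \<alpha> * p" and Q: "0 < Q"
  obtains C where "0 < C" "\<And>u K. \<lbrakk>u \<in> hajlasz_space M d \<alpha> p; 0 < K;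
      hajlasz_norm M d \<alpha> p u < ennreal K\<rbrakk> \<Longrightarrow> Lp_norm M Q u \<le> ennreal (C * K)"
proof -
  obtain C where C: "0 < C" "\<And>u K. \<lbrakk>u \<in> hajlasz_space M d \<alpha> p; 0 < K;
      hajlasz_norm M d \<alpha> p u < ennreal K\<rbrakk> \<Longrightarrow>
      \<exists>v. (AE x in M. u x = v x) \<and> holder_rep (\<alpha> - s / p) (C * K) v"
    using holder_representative[OF \<alpha> p sup] by blast
  let ?m = "1 + measure M (space M)"
  have m: "0 < ?m" by (simp add: add_pos_nonneg)
  have "Lp_norm M Q u \<le> ennreal (C * ?m powr (1 / Q) * K)"
    if u: "u \<in> hajlasz_space M d \<alpha> p" "0 < K" "hajlasz_norm M d \<alpha> p u < ennreal K" for u K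
  proof -
    obtain v where v: "AE x in M. u x = v x" "\<And>x. x \<in> space M \<Longrightarrow> \<bar>v x\<bar> \<le> C * K"
      using C(2)[OF u] unfolding holder_rep_def by blast
    have "(\<integral>\<^sup>+x. ennreal (\<bar>v x\<bar> powr Q) \<partial>M) \<le> (\<integral>\<^sup>+x. ennreal ((C * K) powr Q) \<partial>M)"
      using v(2) Q by (intro nn_integral_mono ennreal_leI powr_mono2) auto
    also have "\<dots> = ennreal ((C * K) powr Q * measure M (space M))"
      by (simp add: emeasure_eq_measure ennreal_mult)
    also have "\<dots> \<le> ennreal ((C * K) powr Q * ?m)"
      by (intro ennreal_leI mult_left_mono) auto
    also have "(C * K) powr Q * ?m = (C * ?m powr (1 / Q) * K) powr Q"
      using C(1) u(2) Q m by (simp add: powr_mult powr_powr)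
    finally have "Lp_norm M Q v \<le> ennreal (C * ?m powr (1 / Q) * K)"
      using Lp_norm_le_iff[OF Q, of "C * ?m powr (1 / Q) * K" M v] C(1) u(2) by simp
    then show ?thesis using Lp_norm_cong_AE[OF v(1)] by simp
  qed
  moreover have "0 < C * ?m powr (1 / Q)" using C(1) m by simp
  ultimately show ?thesis using that by blast
qed

lemma holder_rep_in_holder_space:
  assumes v: "holder_rep \<beta> R v" and \<gamma>: "0 < \<gamma>" "\<gamma> \<le> \<beta>" and R: "0 \<le> R"
  shows "v \<in> holder_space (space M) d \<gamma>" "holder_norm (space M) d \<gamma> v \<le> ennreal (3 * R)"
proof -
  have b: "\<bar>v x\<bar> \<le> R" if "x \<in> space M" for x using v that unfolding holder_rep_def by blast
  have h: "\<bar>v x - v y\<bar> \<le> 2 * R * d x y powr \<gamma>" if "x \<in> space M" "y \<in> space M" for x y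
    using v that unfolding holder_rep_def by (intro holder_lower_exponent[OF that \<gamma>(2,1) R]) auto
  show "v \<in> holder_space (space M) d \<gamma>" using b h R by (intro holder_spaceI[of _ _ R "2 * R"]) auto
  show "holder_norm (space M) d \<gamma> v \<le> ennreal (3 * R)"
    using holder_norm_le[of "space M" v R "2 * R" d \<gamma>] b h R by simp
qed

text \<open>By uniqueness, every element of a Hoelder space that represents \<open>u\<close> inherits the quantitative
  bounds of the representative constructed from gradients.\<close>
lemma holder_rep_transfer:
  assumes v: "v \<in> holder_space (space M) d \<gamma>" "0 < \<gamma>" and w: "holder_rep \<beta> R w" "0 < \<beta>" "0 \<le> R"
    and ae: "AE x in M. u x = v x" "AE x in M. u x = w x"
  shows "holder_rep \<beta> R v"
proof -
  have "AE x in M. v x = w x" using ae by eventually_elim simp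
  then have "v x = w x" if "x \<in> space M" for x
    using holder_eq_if_AE_eq[OF v holder_rep_in_holder_space(1)[OF w(1,2) order_refl w(3)] w(2)] that
    by blast
  then show ?thesis using w(1) by (simp add: holder_rep_def)
qed

lemma continuous_embedding_holder:
  assumes \<alpha>: "0 < \<alpha>" and p: "0 < p" and sup: "s < \<alpha> * p" and \<gamma>: "0 < \<gamma>" "\<gamma> \<le> \<alpha> - s / p"
  shows "continuous_embedding M (hajlasz_space M d \<alpha> p) (hajlasz_norm M d \<alpha> p)
    (holder_space (space M) d \<gamma>) (holder_norm (space M) d \<gamma>)"
proof -
  let ?A = "hajlasz_space M d \<alpha> p" and ?N = "hajlasz_norm M d \<alpha> p"
  let ?B = "holder_space (space M) d \<gamma>"
  obtain C where C: "0 < C" "\<And>u K. \<lbrakk>u \<in> ?A; 0 < K; ?N u < ennreal K\<rbrakk> \<Longrightarrow>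
      \<exists>v. (AE x in M. u x = v x) \<and> holder_rep (\<alpha> - s / p) (C * K) v"
    using holder_representative[OF \<alpha> p sup] by blast
  show ?thesis
    unfolding continuous_embedding_def
  proof (intro conjI ballI impI)
    fix u assume u: "u \<in> ?A"
    then have "?N u < \<infinity>" by (simp add: hajlasz_space_def)
    then obtain n where n: "0 \<le> n" "?N u = ennreal n" by (cases "?N u") auto
    then obtain v where "AE x in M. u x = v x" "holder_rep (\<alpha> - s / p) (C * (n + 1)) v"
      using C(2)[OF u, of "n + 1"] by (auto simp: ennreal_less_iff)
    then show "\<exists>v\<in>?B. AE x in M. u x = v x"
      using holder_rep_in_holder_space(1)[OF _ \<gamma>] C(1) n(1)
      by (meson mult_nonneg_nonneg add_nonneg_nonneg less_imp_le zero_le_one)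
  next
    fix u v w assume vw: "v \<in> ?B" "w \<in> ?B" and "AE x in M. u x = v x" "AE x in M. u x = w x"
    then have "AE x in M. v x = w x" by (elim AE_mp) (auto intro!: AE_I2)
    then have "v x = w x" if "x \<in> space M" for x
      using holder_eq_if_AE_eq[OF vw(1) \<gamma>(1) vw(2) \<gamma>(1)] that by blast
    then have "holder_norm (space M) d \<gamma> (\<lambda>x. v x - w x) \<le> ennreal (0 + 0)"
      by (intro holder_norm_le) auto
    then show "holder_norm (space M) d \<gamma> (\<lambda>x. v x - w x) = 0" by simp
  next
    have "holder_norm (space M) d \<gamma> v \<le> ennreal (3 * C) * ?N u"
      if u: "u \<in> ?A" and v: "v \<in> ?B" and ae: "AE x in M. u x = v x" for u v
    proof (rule norm_bound_from_strict)
      show "?N u < \<infinity>" using u by (simp add: hajlasz_space_def)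
      show "0 \<le> 3 * C" using C(1) by simp
      fix K assume less: "?N u < ennreal K"
      then have K: "0 < K" by (rule ennreal_less_imp_pos)
      obtain w where w: "AE x in M. u x = w x" "holder_rep (\<alpha> - s / p) (C * K) w"
        using C(2)[OF u K less] by blast
      have "holder_rep (\<alpha> - s / p) (C * K) v"
        using \<gamma> C(1) K by (intro holder_rep_transfer[OF v \<gamma>(1) w(2) _ _ ae w(1)]) auto
      from holder_rep_in_holder_space(2)[OF this \<gamma>] C(1) K
      show "holder_norm (space M) d \<gamma> v \<le> ennreal (3 * C * K)" by (simp add: mult.assoc)
    qed
    then show "\<exists>C::real. \<forall>u\<in>?A. \<forall>v\<in>?B. (AE x in M. u x = v x) \<longrightarrow>
        holder_norm (space M) d \<gamma> v \<le> ennreal C * ?N u" by blast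
  qed
qed

lemma compact_embedding_holder:
  assumes \<alpha>: "0 < \<alpha>" and p: "0 < p" and sup: "s < \<alpha> * p" and \<gamma>: "0 < \<gamma>" "\<gamma> < \<alpha> - s / p"
  shows "compact_embedding M (hajlasz_space M d \<alpha> p) (hajlasz_norm M d \<alpha> p)
    (holder_space (space M) d \<gamma>) (holder_norm (space M) d \<gamma>)"
  unfolding compact_embedding_def
proof (intro conjI allI impI)
  show "continuous_embedding M (hajlasz_space M d \<alpha> p) (hajlasz_norm M d \<alpha> p)
    (holder_space (space M) d \<gamma>) (holder_norm (space M) d \<gamma>)"
    using \<gamma> by (intro continuous_embedding_holder[OF \<alpha> p sup]) auto
  fix S assume S: "S \<subseteq> hajlasz_space M d \<alpha> p" "\<exists>K::real. \<forall>u\<in>S. hajlasz_norm M d \<alpha> p u \<le> ennreal K"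
  obtain K where K: "0 < K" "\<And>u. u \<in> S \<Longrightarrow> hajlasz_norm M d \<alpha> p u < ennreal K"
    using bounded_set_uniform_bound[OF S(2)] by blast
  obtain C where C: "0 < C" "\<And>u K. \<lbrakk>u \<in> hajlasz_space M d \<alpha> p; 0 < K;
      hajlasz_norm M d \<alpha> p u < ennreal K\<rbrakk> \<Longrightarrow>
      \<exists>v. (AE x in M. u x = v x) \<and> holder_rep (\<alpha> - s / p) (C * K) v"
    using holder_representative[OF \<alpha> p sup] by blast
  show "totally_bounded_norm (holder_norm (space M) d \<gamma>)
      {v \<in> holder_space (space M) d \<gamma>. \<exists>u\<in>S. AE x in M. u x = v x}"
  proof (rule totally_bounded_holder[OF \<gamma>])
    show "0 \<le> C * K" using C(1) K(1) by simp
    fix v assume "v \<in> {v \<in> holder_space (space M) d \<gamma>. \<exists>u\<in>S. AE x in M. u x = v x}"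
    then obtain u where v: "v \<in> holder_space (space M) d \<gamma>" and u: "u \<in> S" "AE x in M. u x = v x"
      by blast
    obtain w where "AE x in M. u x = w x" "holder_rep (\<alpha> - s / p) (C * K) w"
      using C(2)[OF _ K(1) K(2)[OF u(1)]] S(1) u(1) by blast
    then show "holder_rep (\<alpha> - s / p) (C * K) v"
      using \<gamma> C(1) K(1) by (intro holder_rep_transfer[OF v \<gamma>(1) _ _ _ u(2)]) auto
  qed
qed

end

section \<open>The embedding theorem\<close>

theorem theorem1p4:
  fixes M :: "'a measure" and d :: "'a \<Rightarrow> 'a \<Rightarrow> real" and s \<alpha> p :: real
  assumes "quasi_metric_measure_space M d"
    and "emeasure M (space M) < \<infinity>"
    and "0 < s"
    and "locally_lower_ahlfors_regular M d s"
    and "0 < \<alpha>" and "0 < p"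
  shows
    "(\<alpha> * p < s \<longrightarrow>
        continuous_embedding M
          (hajlasz_space M d \<alpha> p) (hajlasz_norm M d \<alpha> p)
          (Lp_space M (s * p / (s - \<alpha> * p))) (Lp_norm M (s * p / (s - \<alpha> * p))) \<and>
        (\<forall>q. 0 < q \<and> q < s * p / (s - \<alpha> * p) \<longrightarrow>
          compact_embedding M
            (hajlasz_space M d \<alpha> p) (hajlasz_norm M d \<alpha> p)
            (Lp_space M q) (Lp_norm M q))) \<and>
     (s < \<alpha> * p \<longrightarrow>
        continuous_embedding M
          (hajlasz_space M d \<alpha> p) (hajlasz_norm M d \<alpha> p)
          (holder_space (space M) d (\<alpha> - s / p)) (holder_norm (space M) d (\<alpha> - s / p)) \<and>
        (\<forall>\<gamma>. 0 < \<gamma> \<and> \<gamma> < \<alpha> - s / p \<longrightarrow>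
          compact_embedding M
            (hajlasz_space M d \<alpha> p) (hajlasz_norm M d \<alpha> p)
            (holder_space (space M) d \<gamma>) (holder_norm (space M) d \<gamma>)) \<and>
        (\<forall>q. 0 < q \<longrightarrow>
          compact_embedding M
            (hajlasz_space M d \<alpha> p) (hajlasz_norm M d \<alpha> p)
            (Lp_space M q) (Lp_norm M q)))"
proof -
  interpret quasi_metric_measure_space M d by fact
  obtain b where b: "0 < b" "\<And>x r. \<lbrakk>x \<in> space M; 0 < r; r \<le> 1\<rbrakk> \<Longrightarrow>
      ennreal (b * r powr s) \<le> emeasure M (qball (space M) d x r)"
    using assms(4) unfolding locally_lower_ahlfors_regular_def by auto
  obtain C\<^sub>0 C\<^sub>1 where C0: "\<And>x y. \<lbrakk>x \<in> space M; y \<in> space M\<rbrakk> \<Longrightarrow> d y x \<le> C\<^sub>0 * d x y"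
    and C1: "\<And>x y z. \<lbrakk>x \<in> space M; y \<in> space M; z \<in> space M\<rbrakk> \<Longrightarrow>
      d x y \<le> C\<^sub>1 * max (d x z) (d z y)"
    using quasi_symmetric quasi_ultrametric by metis
  define c where "c = max 1 (max C\<^sub>0 C\<^sub>1)"
  interpret ahlfors_space M d s b c
  proof unfold_locales
    fix x y assume xy: "x \<in> space M" "y \<in> space M"
    have "C\<^sub>0 * d x y \<le> c * d x y" using nonneg[OF xy] by (intro mult_right_mono) (auto simp: c_def)
    then show "d y x \<le> c * d x y" using C0[OF xy] by linarith
    fix z assume z: "z \<in> space M"
    have "C\<^sub>1 * max (d x z) (d z y) \<le> c * max (d x z) (d z y)"
      using nonneg[OF xy(1) z] by (intro mult_right_mono) (auto simp: c_def)
    then show "d x y \<le> c * max (d x z) (d z y)" using C1[OF xy z] by linarith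
  qed (use assms b in \<open>auto simp: c_def\<close>)
  note \<alpha> = \<open>0 < \<alpha>\<close> and p = \<open>0 < p\<close>
  show ?thesis
  proof (intro conjI impI allI)
    assume sub: "\<alpha> * p < s"
    obtain C where C: "0 < C" "\<And>u K. \<lbrakk>u \<in> hajlasz_space M d \<alpha> p; 0 < K;
        hajlasz_norm M d \<alpha> p u < ennreal K\<rbrakk> \<Longrightarrow>
        Lp_norm M (s * p / (s - \<alpha> * p)) u \<le> ennreal (C * K)"
      using sobolev_constant[OF \<alpha> p sub] by blast
    have "0 < s * p / (s - \<alpha> * p)" using sub s_pos p by simp
    from continuous_embedding_LpI[OF this less_imp_le[OF C(1)] C(2)]
    show "continuous_embedding M (hajlasz_space M d \<alpha> p) (hajlasz_norm M d \<alpha> p)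
      (Lp_space M (s * p / (s - \<alpha> * p))) (Lp_norm M (s * p / (s - \<alpha> * p)))" .
    fix q assume "0 < q \<and> q < s * p / (s - \<alpha> * p)"
    then show "compact_embedding M (hajlasz_space M d \<alpha> p) (hajlasz_norm M d \<alpha> p)
      (Lp_space M q) (Lp_norm M q)"
      using compact_embedding_Lp[OF p \<alpha> _ _ C] by blast
  next
    assume sup: "s < \<alpha> * p"
    have "0 < \<alpha> - s / p" using sup p by (simp add: field_simps)
    then show "continuous_embedding M (hajlasz_space M d \<alpha> p) (hajlasz_norm M d \<alpha> p)
      (holder_space (space M) d (\<alpha> - s / p)) (holder_norm (space M) d (\<alpha> - s / p))"
      by (intro continuous_embedding_holder[OF \<alpha> p sup]) auto
    fix \<gamma> assume "0 < \<gamma> \<and> \<gamma> < \<alpha> - s / p"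
    then show "compact_embedding M (hajlasz_space M d \<alpha> p) (hajlasz_norm M d \<alpha> p)
      (holder_space (space M) d \<gamma>) (holder_norm (space M) d \<gamma>)"
      by (intro compact_embedding_holder[OF \<alpha> p sup]) auto
  next
    fix q :: real assume sup: "s < \<alpha> * p" and q: "0 < q"
    obtain C where C: "0 < C" "\<And>u K. \<lbrakk>u \<in> hajlasz_space M d \<alpha> p; 0 < K;
        hajlasz_norm M d \<alpha> p u < ennreal K\<rbrakk> \<Longrightarrow> Lp_norm M (q + 1) u \<le> ennreal (C * K)"
      using supercritical_Lp_constant[OF \<alpha> p sup, of "q + 1"] q by auto
    show "compact_embedding M (hajlasz_space M d \<alpha> p) (hajlasz_norm M d \<alpha> p)
      (Lp_space M q) (Lp_norm M q)"
      by (rule compact_embedding_Lp[OF p \<alpha> q _ C]) simp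
  qed
qed

end
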